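(* Let $G$ be a quadrangulation graph with $n\geq 4$ vertices. Then \[ W(G)\leq \begin{cases} \frac{1}{12}n^3+\frac{7}{6}n-2, & \text{if } n\equiv 0 \pmod 2,\\[2pt] \frac{1}{12}n^3+\frac{11}{12}n-1, & \text{if } n\equiv 1 \pmod 2. \end{cases} \]
   Context: All graphs are finite, simple and connected. A quadrangulation graph is a simple plane graph (a planar graph together with a fixed embedding in the plane) in which every face, including the unbounded one, is bounded by a cycle of length 4. For a connected graph $G$, $d_G(u,v)$ denotes the length of a shortest path between $u$ and $v$, and the Wiener index is $W(G)=\sum_{\{u,v\}\subseteq V(G)} d_G(u,v)$, the sum over all unordered pairs of distinct vertices. *)

theory Defs
  imports Complex_Main
begin

text \<open>A finite simple graph is given by a finite vertex set V and a symmetric,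
irreflexive edge relation E (a set of darts, i.e. ordered pairs) on V.
Each undirected edge {u,v} corresponds to the two darts (u,v) and (v,u).\<close>

definition simple_graph :: "'a set \<Rightarrow> ('a \<times> 'a) set \<Rightarrow> bool" where
  "simple_graph V E \<longleftrightarrow> finite V \<and> E \<subseteq> V \<times> V \<and>
     (\<forall>u v. (u, v) \<in> E \<longrightarrow> (v, u) \<in> E) \<and> (\<forall>v. (v, v) \<notin> E)"

fun is_walk :: "('a \<times> 'a) set \<Rightarrow> 'a list \<Rightarrow> bool" where
  "is_walk E [] = False"
| "is_walk E [v] = True"
| "is_walk E (u # v # xs) = ((u, v) \<in> E \<and> is_walk E (v # xs))"

definition walk_betw :: "('a \<times> 'a) set \<Rightarrow> 'a \<Rightarrow> 'a \<Rightarrow> 'a list \<Rightarrow> bool" where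
  "walk_betw E u v xs \<longleftrightarrow> is_walk E xs \<and> hd xs = u \<and> last xs = v"

definition connected_graph :: "'a set \<Rightarrow> ('a \<times> 'a) set \<Rightarrow> bool" where
  "connected_graph V E \<longleftrightarrow> V \<noteq> {} \<and> (\<forall>u\<in>V. \<forall>v\<in>V. \<exists>xs. walk_betw E u v xs)"

definition dist :: "('a \<times> 'a) set \<Rightarrow> 'a \<Rightarrow> 'a \<Rightarrow> nat" where
  "dist E u v = (LEAST k. \<exists>xs. walk_betw E u v xs \<and> length xs = Suc k)"

text \<open>Wiener index: sum of distances over unordered pairs of distinct vertices,
written as half the sum over ordered pairs (dist u u = 0).\<close>
definition wiener :: "'a set \<Rightarrow> ('a \<times> 'a) set \<Rightarrow> real" where
  "wiener V E = (\<Sum>u\<in>V. \<Sum>v\<in>V. real (dist E u v)) / 2"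

text \<open>Plane embeddings, combinatorially (Heffter--Edmonds): a rotation system
\<sigma> is a permutation of the darts which, at every vertex, cyclically permutes
the darts leaving that vertex.  The faces are the orbits of the face permutation
d \<mapsto> \<sigma>(reverse d).  For a connected graph, the embedding is in the sphere
(plane) iff Euler's formula V - E + F = 2 holds.\<close>

definition rotation_system :: "('a \<times> 'a) set \<Rightarrow> ('a \<times> 'a \<Rightarrow> 'a \<times> 'a) \<Rightarrow> bool" where
  "rotation_system E \<sigma> \<longleftrightarrow> bij_betw \<sigma> E E \<and> (\<forall>d\<in>E. fst (\<sigma> d) = fst d) \<and>
     (\<forall>d\<in>E. \<forall>d'\<in>E. fst d = fst d' \<longrightarrow> (\<exists>k. (\<sigma> ^^ k) d = d'))"

definition face_perm :: "('a \<times> 'a \<Rightarrow> 'a \<times> 'a) \<Rightarrow> 'a \<times> 'a \<Rightarrow> 'a \<times> 'a" where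
  "face_perm \<sigma> d = \<sigma> (snd d, fst d)"

definition face_of :: "('a \<times> 'a \<Rightarrow> 'a \<times> 'a) \<Rightarrow> 'a \<times> 'a \<Rightarrow> ('a \<times> 'a) set" where
  "face_of \<sigma> d = {(face_perm \<sigma> ^^ k) d | k. True}"

definition faces :: "('a \<times> 'a) set \<Rightarrow> ('a \<times> 'a \<Rightarrow> 'a \<times> 'a) \<Rightarrow> ('a \<times> 'a) set set" where
  "faces E \<sigma> = face_of \<sigma> ` E"

definition plane_embedding :: "'a set \<Rightarrow> ('a \<times> 'a) set \<Rightarrow> ('a \<times> 'a \<Rightarrow> 'a \<times> 'a) \<Rightarrow> bool" where
  "plane_embedding V E \<sigma> \<longleftrightarrow> rotation_system E \<sigma> \<and>
     int (card V) - int (card E div 2) + int (card (faces E \<sigma>)) = 2"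

definition all_faces_4cycles :: "('a \<times> 'a) set \<Rightarrow> ('a \<times> 'a \<Rightarrow> 'a \<times> 'a) \<Rightarrow> bool" where
  "all_faces_4cycles E \<sigma> \<longleftrightarrow> (\<forall>d\<in>E. (face_perm \<sigma> ^^ 4) d = d \<and>
     inj_on (\<lambda>i. fst ((face_perm \<sigma> ^^ i) d)) {0..<4})"

definition quadrangulation :: "'a set \<Rightarrow> ('a \<times> 'a) set \<Rightarrow> bool" where
  "quadrangulation V E \<longleftrightarrow> simple_graph V E \<and> connected_graph V E \<and>
     (\<exists>\<sigma>. plane_embedding V E \<sigma> \<and> all_faces_4cycles E \<sigma>)"

end

theory Submission
  imports Defs
begin

text \<open>The only consequences of the embedding that matter are that the graph is bipartite and
\<^emph>\<open>linked\<close>: cyclically consecutive neighbours of a vertex have a second common neighbour, so the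
neighbours of \<open>v\<close>, joined when they have a common neighbour other than \<open>v\<close>, form a 2-connected graph.
For linked bipartite graphs the bound is proved by induction on the number \<open>n\<close> of vertices.
Deleting one side of a 2-vertex separation \<open>{x, y}\<close> leaves a linked graph whose distances are not
smaller than the original ones.

If there is no such separation, all distance layers have at least 3 vertices, which bounds every
distance sum by \<open>n (n + 1) / 6\<close>, and at least half of the vertices do better by about \<open>n / 3\<close>.
A vertex of degree 2 is deleted when its distance sum permits; otherwise \<open>n\<close> is odd, the layers around
it have size exactly 2 up to a layer of size at least 3, and the graph is cut just before that layer.
In the remaining case the graph is cut along a separation with smallest side \<open>C\<close>; then the layers
of \<open>C\<close> around \<open>{x, y}\<close> have at least 3 vertices, which pays for the pairs of vertices on different
sides that are nearer to different ones of \<open>x\<close> and \<open>y\<close>.\<close>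

section \<open>Distances in connected graphs\<close>

text \<open>The induction runs over linked graphs because deleting a side of a separation would
  otherwise require a new embedding for what remains; linkedness survives by a local argument at
  \<open>x\<close> and \<open>y\<close>. The obstacle is parity. From \<open>n - 1\<close> to
  \<open>n\<close> the bound grows by \<open>n^2 / 4\<close> if \<open>n\<close> is even, exactly
  the distance sum that layers of size 2 permit, so a vertex of degree 2 can then always be deleted.
  If \<open>n\<close> is odd it grows by only \<open>(n - 1)^2 / 4 + 2\<close>, and the missing
  amount of about \<open>n / 2\<close> has to come from a layer of size at least 3. When the graph
  is cut, the pairs across the cut may cost only what the bound leaves over after both parts have
  used up their own bounds. The worst parity of this remainder, computed in
  \<open>wbound_split\<close>, is the target of both cutting arguments.\<close>

lemma walk_iff_relpow:
  "(\<exists>xs. walk_betw E u v xs \<and> length xs = Suc k) \<longleftrightarrow> (u, v) \<in> E ^^ k"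
proof (induction k arbitrary: u)
  case 0
  have "walk_betw E u v [u]" if "u = v" using that by (simp add: walk_betw_def)
  moreover have "u = v" if "walk_betw E u v xs" "length xs = Suc 0" for xs
    using that by (auto simp: walk_betw_def length_Suc_conv)
  ultimately show ?case by (auto intro: exI[of _ "[u]"])
next
  case (Suc k)
  show ?case
  proof
    assume "\<exists>xs. walk_betw E u v xs \<and> length xs = Suc (Suc k)"
    then obtain a b ys where "walk_betw E u v (a # b # ys)" "length ys = k"
      by (auto simp: length_Suc_conv)
    then have "(u, b) \<in> E" "walk_betw E b v (b # ys)" "length (b # ys) = Suc k"
      by (auto simp: walk_betw_def)
    then show "(u, v) \<in> E ^^ Suc k" using Suc.IH by (blast intro: relpow_Suc_I2)
  next
    assume "(u, v) \<in> E ^^ Suc k"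
    then obtain b where b: "(u, b) \<in> E" "(b, v) \<in> E ^^ k" by (meson relpow_Suc_D2)
    then obtain xs where xs: "walk_betw E b v xs" "length xs = Suc k" using Suc.IH by blast
    then obtain ys where "xs = b # ys" by (cases xs) (auto simp: walk_betw_def)
    then have "walk_betw E u v (u # xs)" using xs b by (auto simp: walk_betw_def)
    then show "\<exists>xs. walk_betw E u v xs \<and> length xs = Suc (Suc k)"
      using xs by (intro exI[of _ "u # xs"]) simp
  qed
qed

text \<open>With distance as a least exponent of the edge relation, the triangle inequality is
  \<open>relpow_add\<close> and monotonicity in \<open>E\<close> is immediate.\<close>

lemma dist_relpow: "dist E u v = (LEAST k. (u, v) \<in> E ^^ k)"
  by (simp add: dist_def walk_iff_relpow)

lemma connected_graph_relpow:
  "connected_graph V E \<longleftrightarrow> V \<noteq> {} \<and> (\<forall>u\<in>V. \<forall>v\<in>V. \<exists>k. (u, v) \<in> E ^^ k)"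
proof -
  have "(\<exists>xs. walk_betw E u v xs) \<longleftrightarrow> (\<exists>k. (u, v) \<in> E ^^ k)" for u v
  proof -
    have "walk_betw E u v xs \<Longrightarrow> length xs = Suc (length xs - 1)" for xs
      by (cases xs) (auto simp: walk_betw_def)
    then show ?thesis by (metis walk_iff_relpow)
  qed
  then show ?thesis by (simp add: connected_graph_def)
qed

lemma connected_graphI:
  assumes sg: "simple_graph V E" and "V \<noteq> {}"
    and cl: "\<And>A. A \<subseteq> V \<Longrightarrow> A \<noteq> {} \<Longrightarrow> E `` A \<subseteq> A \<Longrightarrow> A = V"
  shows "connected_graph V E"
  unfolding connected_graph_relpow
proof (intro conjI ballI)
  fix u v assume uv: "u \<in> V" "v \<in> V"
  have "E\<^sup>* `` {u} \<subseteq> V"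
  proof
    fix w assume "w \<in> E\<^sup>* `` {u}"
    then have "(u, w) \<in> E\<^sup>*" by simp
    then show "w \<in> V" by (induction) (use uv sg in \<open>auto simp: simple_graph_def\<close>)
  qed
  then have "E\<^sup>* `` {u} = V"
    by (rule cl) (auto intro: rtrancl_into_rtrancl)
  then have "(u, v) \<in> E\<^sup>*" using uv by blast
  then show "\<exists>k. (u, v) \<in> E ^^ k" by (simp add: rtrancl_is_UN_relpow)
qed fact

locale conn_graph =
  fixes V :: "'a set" and E :: "('a \<times> 'a) set"
  assumes simple: "simple_graph V E" and connected: "connected_graph V E"
begin

abbreviation nb :: "'a \<Rightarrow> 'a set" where "nb v \<equiv> E `` {v}"

lemma finite_V [simp]: "finite V" using simple by (simp add: simple_graph_def)
lemma edge_sym: "(u, v) \<in> E \<Longrightarrow> (v, u) \<in> E" using simple by (auto simp: simple_graph_def)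
lemma edge_V: "(u, v) \<in> E \<Longrightarrow> u \<in> V \<and> v \<in> V" using simple by (auto simp: simple_graph_def)
lemma edge_irrefl [simp]: "(u, u) \<notin> E" using simple by (auto simp: simple_graph_def)
lemma nb_V: "nb v \<subseteq> V" using edge_V by auto
lemma finite_nb [simp]: "finite (nb v)" using nb_V finite_V finite_subset by blast
lemma finite_sub: "A \<subseteq> V \<Longrightarrow> finite A" using finite_V finite_subset by blast

lemma closed_eq_V:
  assumes "A \<subseteq> V" "A \<noteq> {}" "E `` A \<subseteq> A"
  shows "A = V"
proof -
  obtain a where a: "a \<in> A" using assms by auto
  have "v \<in> A" if "v \<in> V" for v
  proof -
    have "(a, v) \<in> E\<^sup>*" using connected a that assms(1)
      unfolding connected_graph_relpow by (auto simp: rtrancl_is_UN_relpow)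
    then show ?thesis by induction (use a assms in auto)
  qed
  then show ?thesis using assms by auto
qed

lemma relpow_dist: "u \<in> V \<Longrightarrow> v \<in> V \<Longrightarrow> (u, v) \<in> E ^^ dist E u v"
  using connected unfolding dist_relpow connected_graph_relpow by (meson LeastI_ex)

lemma dist_le: "(u, v) \<in> E ^^ k \<Longrightarrow> dist E u v \<le> k"
  unfolding dist_relpow by (rule Least_le)

lemma dist_refl [simp]: "dist E u u = 0"
  using dist_le[of u u 0] by simp

lemma relpow_sym: "(u, v) \<in> E ^^ k \<Longrightarrow> (v, u) \<in> E ^^ k"
proof (induction k arbitrary: v)
  case (Suc k)
  then obtain w where "(u, w) \<in> E ^^ k" "(w, v) \<in> E" by auto
  then show ?case using Suc.IH edge_sym by (blast intro: relpow_Suc_I2)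
qed simp

lemma dist_sym: "dist E u v = dist E v u"
proof -
  have "(u, v) \<in> E ^^ k \<longleftrightarrow> (v, u) \<in> E ^^ k" for k using relpow_sym by blast
  then show ?thesis by (simp add: dist_relpow)
qed

lemma dist_eq_0: "u \<in> V \<Longrightarrow> v \<in> V \<Longrightarrow> dist E u v = 0 \<longleftrightarrow> u = v"
  using relpow_dist[of u v] by auto

lemma dist_triangle:
  assumes "u \<in> V" "v \<in> V" "w \<in> V"
  shows "dist E u w \<le> dist E u v + dist E v w"
  using relpow_dist[OF assms(1,2)] relpow_dist[OF assms(2,3)]
  by (intro dist_le) (auto simp: relpow_add)

lemma dist_edge_le:
  assumes "u \<in> V" "(v, w) \<in> E"
  shows "dist E u w \<le> Suc (dist E u v)"
  using relpow_dist[OF assms(1), of v] assms(2) edge_V by (intro dist_le) auto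

lemma dist_edge: "(u, v) \<in> E \<Longrightarrow> dist E u v = 1"
  using dist_edge_le[of u u v] dist_eq_0[of u v] edge_V[of u v] by force

lemma dist_pred:
  assumes "u \<in> V" "v \<in> V" "dist E u v = Suc k"
  shows "\<exists>w. (w, v) \<in> E \<and> dist E u w = k"
proof -
  have "(u, v) \<in> E ^^ Suc k" using relpow_dist assms by metis
  then obtain w where w: "(u, w) \<in> E ^^ k" "(w, v) \<in> E" by auto
  then have "dist E u w \<le> k" "Suc k \<le> Suc (dist E u w)"
    using dist_le dist_edge_le[of u w v] assms by auto
  then show ?thesis using w by auto
qed

lemma dist_Suc0: "u \<in> V \<Longrightarrow> v \<in> V \<Longrightarrow> dist E u v = Suc 0 \<longleftrightarrow> (u, v) \<in> E"
  using dist_pred[of u v 0] dist_edge[of u v] dist_eq_0[of u] edge_V by fastforce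

text \<open>The direction that the induction needs: a bound for the smaller graph also bounds the
  distances measured in the larger one.\<close>

lemma dist_le_subgraph:
  assumes "E' \<subseteq> E" "conn_graph V' E'" "u \<in> V'" "v \<in> V'"
  shows "dist E u v \<le> dist E' u v"
proof -
  have "E' ^^ k \<subseteq> E ^^ k" for k using assms(1) by (induction k) auto
  then show ?thesis
    using conn_graph.relpow_dist[OF assms(2-4)] dist_le by blast
qed

end

section \<open>Sums over layers\<close>

text \<open>A layer has to be large only if something lies beyond it. The outermost layer separates
  nothing and is exempt.\<close>

definition layered :: "nat \<Rightarrow> 'a set \<Rightarrow> ('a \<Rightarrow> nat) \<Rightarrow> bool" where
  "layered k A d \<longleftrightarrow> (\<forall>i\<ge>1. (\<exists>u\<in>A. i < d u) \<longrightarrow> k \<le> card {u\<in>A. d u = i})"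

text \<open>One step of a recursion: every element pays 1, the first layer is done, and the rest
  continues with \<open>d\<close> lowered by 1.\<close>

lemma layer_peel:
  assumes fin: "finite A" and pos: "\<forall>u\<in>A. 1 \<le> d u"
  shows "sum d A = card A + sum (\<lambda>u. d u - 1) {u\<in>A. 1 < d u}"
    and "card {u\<in>A. 1 < d u} + card {u\<in>A. d u = 1} = card A"
    and "layered k A d \<Longrightarrow> layered k {u\<in>A. 1 < d u} (\<lambda>u. d u - 1)"
proof -
  have "sum d A = (\<Sum>u\<in>A. 1 + (d u - 1))" using pos by (intro sum.cong) auto
  also have "\<dots> = card A + (\<Sum>u\<in>A. d u - 1)" by (simp only: sum.distrib) simp
  also have "(\<Sum>u\<in>A. d u - 1) = sum (\<lambda>u. d u - 1) {u\<in>A. 1 < d u}"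
    using pos fin by (intro sum.mono_neutral_right) auto
  finally show "sum d A = card A + sum (\<lambda>u. d u - 1) {u\<in>A. 1 < d u}" .
  have "A = {u\<in>A. 1 < d u} \<union> {u\<in>A. d u = 1}" using pos by force
  then have "card A = card ({u\<in>A. 1 < d u} \<union> {u\<in>A. d u = 1})" by simp
  also have "\<dots> = card {u\<in>A. 1 < d u} + card {u\<in>A. d u = 1}"
    using fin by (intro card_Un_disjoint) auto
  finally show "card {u\<in>A. 1 < d u} + card {u\<in>A. d u = 1} = card A" ..
  assume lay: "layered k A d"
  show "layered k {u\<in>A. 1 < d u} (\<lambda>u. d u - 1)"
    unfolding layered_def
  proof (intro allI impI)
    fix i :: nat
    assume i: "1 \<le> i" "\<exists>u\<in>{u \<in> A. 1 < d u}. i < d u - 1"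
    have eq: "{u \<in> {u \<in> A. 1 < d u}. d u - 1 = i} = {u\<in>A. d u = Suc i}" using i by auto
    have "\<exists>u\<in>A. Suc i < d u" using i by force
    then show "k \<le> card {u \<in> {u \<in> A. 1 < d u}. d u - 1 = i}"
      unfolding eq using lay by (auto simp: layered_def)
  qed
qed

text \<open>\<open>\<phi>\<close> acts as a potential: \<open>step\<close> pays for peeling a layer
  of at least \<open>k\<close> elements, and \<open>base\<close> pays for the last layer.\<close>

lemma layer_sum:
  fixes \<phi> :: "nat \<Rightarrow> real"
  assumes step: "\<And>a b. b + k \<le> a \<Longrightarrow> real a + \<phi> b \<le> \<phi> a" and base: "\<And>a. real a \<le> \<phi> a"
    and fin: "finite A" and pos: "\<forall>u\<in>A. 1 \<le> d u" and lay: "layered k A d" and k: "1 \<le> k"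
  shows "real (sum d A) \<le> \<phi> (card A)"
  using fin pos lay
proof (induction "card A" arbitrary: A d rule: less_induct)
  case less
  let ?B = "{u\<in>A. 1 < d u}"
  note peel = layer_peel[OF less.prems(1,2)]
  show ?case
  proof (cases "?B = {}")
    case True
    then have "sum d A = card A" using peel(1) by (simp only: True) simp
    then show ?thesis using base by simp
  next
    case False
    then have "k \<le> card {u\<in>A. d u = 1}"
      using less.prems(3) unfolding layered_def by auto
    then have le: "card ?B + k \<le> card A" using peel(2) by linarith
    have "real (sum (\<lambda>u. d u - 1) ?B) \<le> \<phi> (card ?B)"
      by (rule less.hyps) (use le k less.prems peel(3) in auto)
    then show ?thesis using peel(1) step[OF le] by simp
  qed
qed

text \<open>\<open>\<phi>\<^sub>2\<close> and \<open>\<phi>\<^sub>3\<close> are the quadratic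
  solutions of \<open>\<phi> a = a + \<phi> (a - k)\<close> for \<open>k = 2\<close> and
  \<open>k = 3\<close>. Their constant terms make \<open>a \<le> \<phi> a\<close> sharp at
  \<open>a = 1\<close>, for \<open>\<phi>\<^sub>3\<close> also at \<open>a = 2\<close>.\<close>

definition \<phi>\<^sub>2 :: "nat \<Rightarrow> real" where "\<phi>\<^sub>2 a = (real a + 1)\<^sup>2 / 4"
definition \<phi>\<^sub>3 :: "nat \<Rightarrow> real" where "\<phi>\<^sub>3 a = (real a + 1) * (real a + 2) / 6"

lemma \<phi>\<^sub>2_mono: "a \<le> b \<Longrightarrow> \<phi>\<^sub>2 a \<le> \<phi>\<^sub>2 b"
  by (simp add: \<phi>\<^sub>2_def power_mono)

lemma \<phi>\<^sub>3_mono: "a \<le> b \<Longrightarrow> \<phi>\<^sub>3 a \<le> \<phi>\<^sub>3 b"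
  by (simp add: \<phi>\<^sub>3_def mult_mono)

lemma layer_sum2:
  assumes "finite A" "\<forall>u\<in>A. 1 \<le> d u" "layered 2 A d"
  shows "real (sum d A) \<le> \<phi>\<^sub>2 (card A)"
proof (rule layer_sum[where k = 2])
  fix a b :: nat assume ab: "b + 2 \<le> a"
  have "real b + 1 \<le> real a - 1" using ab by simp
  then have "(real b + 1)\<^sup>2 \<le> (real a - 1)\<^sup>2" by (intro power_mono) auto
  moreover have "(real a + 1)\<^sup>2 = (real a - 1)\<^sup>2 + 4 * real a"
    by (simp add: power2_eq_square algebra_simps)
  ultimately show "real a + \<phi>\<^sub>2 b \<le> \<phi>\<^sub>2 a" by (simp add: \<phi>\<^sub>2_def)
next
  fix a :: nat
  have "0 \<le> (real a - 1)\<^sup>2" by simp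
  then show "real a \<le> \<phi>\<^sub>2 a" by (simp add: \<phi>\<^sub>2_def power2_eq_square algebra_simps)
qed (use assms in auto)

lemma layer_sum3:
  assumes "finite A" "\<forall>u\<in>A. 1 \<le> d u" "layered 3 A d"
  shows "real (sum d A) \<le> \<phi>\<^sub>3 (card A)"
proof (rule layer_sum[where k = 3])
  fix a b :: nat assume ab: "b + 3 \<le> a"
  have "\<phi>\<^sub>3 b \<le> \<phi>\<^sub>3 (a - 3)" using ab by (intro \<phi>\<^sub>3_mono) simp
  also have "\<phi>\<^sub>3 (a - 3) = \<phi>\<^sub>3 a - real a"
    using ab by (simp add: \<phi>\<^sub>3_def of_nat_diff field_simps)
  finally show "real a + \<phi>\<^sub>3 b \<le> \<phi>\<^sub>3 a" by simp
next
  fix a :: nat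
  have "0 \<le> (real a - 1) * (real a - 2)"
  \<comment> \<open>The product is negative strictly between 1 and 2, so integrality of
    \<open>a\<close> is essential.\<close>
  proof (cases "a \<le> 1")
    case True
    then have "a = 0 \<or> a = 1" by auto
    then show ?thesis by auto
  qed (auto intro: mult_nonneg_nonneg)
  then show "real a \<le> \<phi>\<^sub>3 a" by (simp add: \<phi>\<^sub>3_def algebra_simps)
qed (use assms in auto)

text \<open>A first layer known to exceed the general lower bound is peeled off separately, which
  leaves fewer elements to be charged later. The \<open>second\<close> variants do this for the
  first two layers.\<close>

lemma layer_sum2_first:
  assumes "finite A" "\<forall>u\<in>A. 1 \<le> d u" "layered 2 A d" and "j \<le> card {u\<in>A. d u = 1}"
  shows "real (sum d A) \<le> real (card A) + \<phi>\<^sub>2 (card A - j)"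
proof -
  note peel = layer_peel[OF assms(1,2)]
  have "real (sum (\<lambda>u. d u - 1) {u\<in>A. 1 < d u}) \<le> \<phi>\<^sub>2 (card {u\<in>A. 1 < d u})"
    by (rule layer_sum2) (use assms peel(3) in auto)
  also have "\<dots> \<le> \<phi>\<^sub>2 (card A - j)" using peel(2) assms(4) by (intro \<phi>\<^sub>2_mono) linarith
  finally show ?thesis using peel(1) by simp
qed

lemma layer_sum3_first:
  assumes "finite A" "\<forall>u\<in>A. 1 \<le> d u" "layered 3 A d" and "j \<le> card {u\<in>A. d u = 1}"
  shows "real (sum d A) \<le> real (card A) + \<phi>\<^sub>3 (card A - j)"
proof -
  note peel = layer_peel[OF assms(1,2)]
  have "real (sum (\<lambda>u. d u - 1) {u\<in>A. 1 < d u}) \<le> \<phi>\<^sub>3 (card {u\<in>A. 1 < d u})"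
    by (rule layer_sum3) (use assms peel(3) in auto)
  also have "\<dots> \<le> \<phi>\<^sub>3 (card A - j)" using peel(2) assms(4) by (intro \<phi>\<^sub>3_mono) linarith
  finally show ?thesis using peel(1) by simp
qed

lemma peel_second:
  "{u \<in> {u\<in>A. 1 < d u}. d u - 1 = 1} = {u\<in>A. d u = (2::nat)}" by auto

lemma layer_sum2_second:
  assumes "finite A" "\<forall>u\<in>A. 1 \<le> d u" "layered 2 A d"
    and "i \<le> card {u\<in>A. d u = 1}" "j \<le> card {u\<in>A. d u = 2}"
  shows "real (sum d A) \<le> real (card A) + real (card A - i) + \<phi>\<^sub>2 (card A - i - j)"
proof -
  let ?B = "{u\<in>A. 1 < d u}"
  note peel = layer_peel[OF assms(1,2)]
  have le: "card ?B \<le> card A - i" using peel(2) assms(4) by linarith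
  have "real (sum (\<lambda>u. d u - 1) ?B) \<le> real (card ?B) + \<phi>\<^sub>2 (card ?B - j)"
    by (rule layer_sum2_first) (unfold peel_second, use assms peel(3) in auto)
  also have "\<dots> \<le> real (card A - i) + \<phi>\<^sub>2 (card A - i - j)"
    using le by (intro add_mono \<phi>\<^sub>2_mono) auto
  finally show ?thesis using peel(1) by simp
qed

lemma layer_sum3_second:
  assumes "finite A" "\<forall>u\<in>A. 1 \<le> d u" "layered 3 A d"
    and "i \<le> card {u\<in>A. d u = 1}" "j \<le> card {u\<in>A. d u = 2}"
  shows "real (sum d A) \<le> real (card A) + real (card A - i) + \<phi>\<^sub>3 (card A - i - j)"
proof -
  let ?B = "{u\<in>A. 1 < d u}"
  note peel = layer_peel[OF assms(1,2)]
  have le: "card ?B \<le> card A - i" using peel(2) assms(4) by linarith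
  have "real (sum (\<lambda>u. d u - 1) ?B) \<le> real (card ?B) + \<phi>\<^sub>3 (card ?B - j)"
    by (rule layer_sum3_first) (unfold peel_second, use assms peel(3) in auto)
  also have "\<dots> \<le> real (card A - i) + \<phi>\<^sub>3 (card A - i - j)"
    using le by (intro add_mono \<phi>\<^sub>3_mono) auto
  finally show ?thesis using peel(1) by simp
qed

section \<open>Linked graphs and 2-vertex separations\<close>

text \<open>In \<open>linked\<close>, the at most one neighbour outside \<open>X\<close> and
  \<open>Y\<close> is the vertex whose removal must not disconnect the neighbours of
  \<open>v\<close>; \<open>X\<close> and \<open>Y\<close> are an arbitrary split of the
  others.\<close>

locale linked_graph = conn_graph +
  assumes bipartite: "\<exists>col :: 'a \<Rightarrow> bool. \<forall>u v. (u, v) \<in> E \<longrightarrow> col u \<noteq> col v"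
    and deg_ge_2: "v \<in> V \<Longrightarrow> 2 \<le> card (E `` {v})"
    and linked: "\<lbrakk>v \<in> V; X \<noteq> {}; Y \<noteq> {}; X \<inter> Y = {}; X \<union> Y \<subseteq> E `` {v};
      card (E `` {v} - (X \<union> Y)) \<le> 1\<rbrakk>
      \<Longrightarrow> \<exists>p\<in>X. \<exists>q\<in>Y. \<exists>w. w \<noteq> v \<and> (p, w) \<in> E \<and> (q, w) \<in> E"
begin

definition col :: "'a \<Rightarrow> bool" where
  "col = (SOME c. \<forall>u v. (u, v) \<in> E \<longrightarrow> c u \<noteq> c v)"

lemma col_edge: "(u, v) \<in> E \<Longrightarrow> col v = (\<not> col u)"
  using someI_ex[OF bipartite] unfolding col_def[symmetric] by blast

text \<open>A cut vertex \<open>s\<close> would have neighbours on both sides. \<open>linked\<close>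
  gives two of them, on different sides, a common neighbour other than \<open>s\<close>, and
  whichever side contains it, an edge crosses. The form with a boundary set \<open>S\<close> lets
  distance layers be plugged in directly.\<close>

lemma two_connected:
  assumes A: "A \<subseteq> V" "A \<noteq> {}" "A \<inter> S = {}" and S: "finite S" "card S \<le> 1" and cl: "E `` A \<subseteq> A \<union> S"
  shows "V \<subseteq> A \<union> S"
proof (rule ccontr)
  assume not: "\<not> V \<subseteq> A \<union> S"
  have "S \<noteq> {}" using closed_eq_V[OF A(1,2)] cl not by auto
  then obtain s where s: "S = {s}" using S by (metis One_nat_def card_1_singletonE card_0_eq le_Suc_eq le_zero_eq)
  define B where "B = V - A - {s}"
  have B: "B \<noteq> {}" using not by (auto simp: B_def s)
  have noAB: "(a, b) \<notin> E" if "a \<in> A" "b \<in> B" for a b using that cl by (auto simp: B_def s)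
  have nA: "nb s \<inter> A \<noteq> {}"
  proof
    assume "nb s \<inter> A = {}"
    then have "E `` A \<subseteq> A" using cl edge_sym by (auto simp: s)
    then show False using closed_eq_V[OF A(1,2)] not by auto
  qed
  then have sV: "s \<in> V" using edge_V by auto
  have nB: "nb s \<inter> B \<noteq> {}"
  proof
    assume no: "nb s \<inter> B = {}"
    have "E `` B \<subseteq> B"
    proof
      fix w assume "w \<in> E `` B"
      then obtain b where b: "b \<in> B" "(b, w) \<in> E" by auto
      then have "w \<in> V" "w \<notin> A" "w \<noteq> s" using edge_V noAB edge_sym no by blast+
      then show "w \<in> B" by (simp add: B_def)
    qed
    then have "B = V" using B by (intro closed_eq_V) (auto simp: B_def)
    then show False using A by (auto simp: B_def)
  qed
  have "nb s \<subseteq> A \<union> B" using edge_V by (auto simp: B_def)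
  then have "nb s - (nb s \<inter> A \<union> nb s \<inter> B) = {}" by auto
  then have "card (nb s - (nb s \<inter> A \<union> nb s \<inter> B)) \<le> 1" by (simp only: card.empty)
  moreover have "(nb s \<inter> A) \<inter> (nb s \<inter> B) = {}" by (auto simp: B_def)
  ultimately obtain p q w where w: "p \<in> nb s \<inter> A" "q \<in> nb s \<inter> B" "w \<noteq> s" "(p, w) \<in> E" "(q, w) \<in> E"
    using linked[OF sV nA nB] by (metis Int_lower1 Un_least)
  then have "w \<in> V" using edge_V by blast
  then have "w \<in> A \<or> w \<in> B" using w by (auto simp: B_def)
  then show False
  proof
    assume "w \<in> A" then show False using noAB[of w q] edge_sym[OF w(5)] w(2) by simp
  next
    assume "w \<in> B" then show False using noAB[of p w] w by simp
  qed
qed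

text \<open>A side \<open>C\<close> of a separation may be a union of several components. Hence the
  opposite side is again a fragment and both sides can be treated alike.\<close>

definition frag :: "'a \<Rightarrow> 'a \<Rightarrow> 'a set \<Rightarrow> bool" where
  "frag x y C \<longleftrightarrow> C \<noteq> {} \<and> C \<subseteq> V \<and> x \<in> V \<and> y \<in> V \<and> x \<noteq> y \<and> x \<notin> C \<and> y \<notin> C \<and>
     E `` C \<subseteq> C \<union> {x, y} \<and> V - C - {x, y} \<noteq> {}"

abbreviation opp :: "'a \<Rightarrow> 'a \<Rightarrow> 'a set \<Rightarrow> 'a set" where
  "opp x y C \<equiv> V - C - {x, y}"

lemma frag_commute: "frag x y C \<Longrightarrow> frag y x C"
  by (auto simp: frag_def)

lemma frag_no_edge: "frag x y C \<Longrightarrow> c \<in> C \<Longrightarrow> d \<in> opp x y C \<Longrightarrow> (c, d) \<notin> E \<and> (d, c) \<notin> E"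
  unfolding frag_def using edge_sym by blast

lemma frag_opp:
  assumes "frag x y C" shows "frag x y (opp x y C)" and "opp x y (opp x y C) = C"
proof -
  have "E `` opp x y C \<subseteq> opp x y C \<union> {x, y}"
    using frag_no_edge[OF assms] edge_V by blast
  moreover show "opp x y (opp x y C) = C" using assms by (auto simp: frag_def)
  ultimately show "frag x y (opp x y C)" using assms by (auto simp: frag_def)
qed

lemma frag_nb:
  assumes "frag x y C"
  shows "nb x \<inter> C \<noteq> {}"
proof
  assume "nb x \<inter> C = {}"
  then have "E `` C \<subseteq> C \<union> {y}" using assms edge_sym by (fastforce simp: frag_def)
  then have "V \<subseteq> C \<union> {y}" using assms by (intro two_connected) (auto simp: frag_def)
  then show False using assms by (auto simp: frag_def)
qed

text \<open>A vertex of \<open>C\<close> and one of the opposite side can have no common neighbours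
  except \<open>x\<close> and \<open>y\<close>, so \<open>linked\<close> at \<open>x\<close> must
  deliver \<open>y\<close>.\<close>

lemma frag_linked:
  assumes fr: "frag x y C" and X: "X \<subseteq> nb x \<inter> C" "X \<noteq> {}" "Y \<subseteq> nb x \<inter> opp x y C" "Y \<noteq> {}"
    and c: "card (nb x - (X \<union> Y)) \<le> 1"
  shows "\<exists>p\<in>X. \<exists>q\<in>Y. (y, p) \<in> E \<and> (y, q) \<in> E"
proof -
  have "x \<in> V" "X \<inter> Y = {}" "X \<union> Y \<subseteq> nb x" using fr X by (auto simp: frag_def)
  then obtain p q w where w: "p \<in> X" "q \<in> Y" "w \<noteq> x" "(p, w) \<in> E" "(q, w) \<in> E"
    using linked[OF _ X(2,4) _ _ c] by metis
  have "w \<in> V" using edge_V w by blast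
  moreover have "w \<notin> C" "w \<notin> opp x y C" using frag_no_edge[OF fr] w X by blast+
  ultimately have "w = y" using w by auto
  then show ?thesis using w edge_sym by blast
qed

lemma frag_common:
  assumes fr: "frag x y C"
  obtains p q where "p \<in> C" "q \<in> opp x y C" "(x, p) \<in> E" "(x, q) \<in> E" "(y, p) \<in> E" "(y, q) \<in> E"
proof -
  have "nb x - (nb x \<inter> C \<union> nb x \<inter> opp x y C) \<subseteq> {y}" using edge_V by auto
  then have "card (nb x - (nb x \<inter> C \<union> nb x \<inter> opp x y C)) \<le> card {y}" by (intro card_mono) auto
  then show ?thesis
    using frag_linked[OF fr, of "nb x \<inter> C" "nb x \<inter> opp x y C"] frag_nb[OF fr] frag_nb[OF frag_opp(1)[OF fr]] that
    by auto
qed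

lemma frag_col: "frag x y C \<Longrightarrow> col x = col y"
  by (metis col_edge frag_common)

lemma frag_nonadjacent: "frag x y C \<Longrightarrow> (x, y) \<notin> E"
  using col_edge[of x y] frag_col[of x y C] by auto

lemma frag_dist: "frag x y C \<Longrightarrow> dist E x y = 2"
proof -
  assume fr: "frag x y C"
  then have V: "x \<in> V" "y \<in> V" "x \<noteq> y" by (auto simp: frag_def)
  obtain p where p: "(x, p) \<in> E" "(y, p) \<in> E" using frag_common[OF fr] by metis
  have "dist E x y \<le> 2"
    using dist_edge_le[of x p y] V p edge_sym dist_edge[OF p(1)] by fastforce
  moreover have "dist E x y \<noteq> 0" using V by (simp add: dist_eq_0)
  moreover have "dist E x y \<noteq> Suc 0" using V frag_nonadjacent[OF fr] by (simp add: dist_Suc0)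
  ultimately show ?thesis by linarith
qed

text \<open>If \<open>p\<close> were the only common neighbour in \<open>C\<close>, linkedness at
  \<open>x\<close> with \<open>p\<close> left out would show that \<open>x\<close> has no other
  neighbour in \<open>C\<close>. Then \<open>p\<close> and \<open>y\<close> would separate
  \<open>C - {p}\<close>, but they are adjacent, against \<open>frag_nonadjacent\<close>.\<close>

lemma frag_two_common:
  assumes fr: "frag x y C" and C: "2 \<le> card C"
  shows "\<exists>p p'. p \<noteq> p' \<and> {p, p'} \<subseteq> C \<inter> nb x \<inter> nb y"
proof (rule ccontr)
  assume not: "\<not> ?thesis"
  obtain p q where p: "p \<in> C" "(x, p) \<in> E" "(y, p) \<in> E" using frag_common[OF fr] by metis
  then have only: "p' = p" if "p' \<in> C" "(x, p') \<in> E" "(y, p') \<in> E" for p'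
    using not that by auto
  have "nb x \<inter> C = {p}"
  proof (rule ccontr)
    assume "nb x \<inter> C \<noteq> {p}"
    then have ne: "nb x \<inter> C - {p} \<noteq> {}" using p by auto
    have "nb x - ((nb x \<inter> C - {p}) \<union> nb x \<inter> opp x y C) \<subseteq> {p}"
      using edge_V frag_nonadjacent[OF fr] by auto
    then have "card (nb x - ((nb x \<inter> C - {p}) \<union> nb x \<inter> opp x y C)) \<le> card {p}"
      by (intro card_mono) auto
    then have "\<exists>p'\<in>nb x \<inter> C - {p}. \<exists>q\<in>nb x \<inter> opp x y C. (y, p') \<in> E \<and> (y, q) \<in> E"
      by (intro frag_linked[OF fr _ ne _ frag_nb[OF frag_opp(1)[OF fr]]]) auto
    then show False using only by auto
  qed
  then have x: "(c, x) \<notin> E" if "c \<in> C - {p}" for c using that edge_sym by blast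
  have "C - {p} \<noteq> {}"
  proof
    assume "C - {p} = {}"
    then have "card C \<le> card {p}" by (intro card_mono) auto
    then show False using C by simp
  qed
  moreover have "E `` (C - {p}) \<subseteq> (C - {p}) \<union> {p, y}"
    using x fr unfolding frag_def by blast
  moreover have "x \<in> V - (C - {p}) - {p, y}" using fr p by (auto simp: frag_def)
  ultimately have "frag p y (C - {p})" using fr p by (auto simp: frag_def)
  then show False using frag_nonadjacent p edge_sym by blast
qed

text \<open>Only links through \<open>C\<close> are lost. A deleted vertex can link two remaining
  ones only if these are \<open>x\<close> and \<open>y\<close>, and the two common neighbours
  \<open>d\<close> and \<open>d'\<close> on the kept side, available since that side has at least
  two vertices, replace it.\<close>

lemma frag_delete:
  assumes fr: "frag x y C" and D: "2 \<le> card (opp x y C)"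
  defines "V' \<equiv> V - C"
  defines "E' \<equiv> E \<inter> V' \<times> V'"
  shows "linked_graph V' E'"
proof -
  let ?D = "opp x y C"
  note fo = frag_opp[OF fr]
  have xy: "x \<in> V'" "y \<in> V'" "x \<noteq> y" using fr by (auto simp: frag_def V'_def)
  have V': "V' = ?D \<union> {x, y}" using xy by (auto simp: V'_def)
  obtain d d' where dd: "d \<noteq> d'" "{d, d'} \<subseteq> ?D \<inter> nb x \<inter> nb y" using frag_two_common[OF fo(1) D] by blast
  then have d': "(x, d) \<in> E'" "(x, d') \<in> E'" "(y, d) \<in> E'" "(y, d') \<in> E'" "(d, x) \<in> E'" "(d, y) \<in> E'"
      "(d', x) \<in> E'" "(d', y) \<in> E'"
    using edge_sym V' by (auto simp: E'_def)
  have nbD: "E' `` {v} = nb v" if "v \<in> ?D" for v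
    using that frag_no_edge[OF fr] edge_V by (auto simp: E'_def V'_def)
  have sg: "simple_graph V' E'" using edge_sym by (auto simp: simple_graph_def E'_def V'_def)
  have cg: "connected_graph V' E'"
  proof (rule connected_graphI[OF sg])
    show "V' \<noteq> {}" using xy by auto
    fix A assume A: "A \<subseteq> V'" "A \<noteq> {}" "E' `` A \<subseteq> A"
    have eq: "x \<in> A \<longleftrightarrow> y \<in> A" using A(3) d' by blast
    show "A = V'"
    proof (cases "x \<in> A")
      case True
      \<comment> \<open>Restoring \<open>C\<close> gives a closed set of the old connected graph,
        since \<open>x\<close> and \<open>y\<close> both lie in \<open>A\<close>.\<close>
      have "E `` (A \<union> C) \<subseteq> A \<union> C"
      proof
        fix w assume "w \<in> E `` (A \<union> C)"
        then obtain u where u: "u \<in> A \<union> C" "(u, w) \<in> E" by auto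
        show "w \<in> A \<union> C"
        proof (cases "w \<in> C")
          case w: False
          then have "w \<in> V'" using u edge_V by (auto simp: V'_def)
          show ?thesis
          proof (cases "u \<in> C")
            case True
            then show ?thesis using fr u eq \<open>x \<in> A\<close> unfolding frag_def by blast
          next
            case False
            then have "(u, w) \<in> E'" "u \<in> A" using u A \<open>w \<in> V'\<close> by (auto simp: E'_def)
            then show ?thesis using A(3) by blast
          qed
        qed simp
      qed
      then have "A \<union> C = V" using A fr by (intro closed_eq_V) (auto simp: V'_def frag_def)
      then show ?thesis using A by (auto simp: V'_def)
    next
      case False
      then have AD: "A \<subseteq> ?D" using eq A(1) V' by auto
      then have "E `` A \<subseteq> A" using nbD A(3) by (blast)
      then have "A = V" using A by (intro closed_eq_V) (auto simp: V'_def)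
      then show ?thesis using False xy by (auto simp: V'_def)
    qed
  qed
  \<comment> \<open>The old neighbours of \<open>a\<close> in \<open>C\<close> are added to
    \<open>Y\<close> before \<open>linked\<close> is applied in the old graph. A \<open>q\<close> in
    \<open>C\<close> would force \<open>w = b\<close>, which \<open>noX\<close> excludes, so the
    link found survives. If both sets meet \<open>nb b\<close>, then \<open>b\<close> itself is the
    link.\<close>
  have at_x: "\<exists>p\<in>X. \<exists>q\<in>Y. \<exists>w. w \<noteq> a \<and> (p, w) \<in> E' \<and> (q, w) \<in> E'"
    if ab: "a = x \<and> b = y \<or> a = y \<and> b = x" and X: "X \<noteq> {}" "Y \<noteq> {}" "X \<inter> Y = {}" "X \<union> Y \<subseteq> E' `` {a}"
      "card (E' `` {a} - (X \<union> Y)) \<le> 1" and noX: "X \<inter> nb b = {}" for a b X Y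
  proof -
    have fr': "frag a b C" using ab fr frag_commute by metis
    have aV: "a \<in> V'" "a \<in> V" using ab xy by (auto simp: V'_def)
    have V'': "V' = ?D \<union> {a, b}" using V' ab by auto
    have "E' `` {a} \<subseteq> nb a \<inter> ?D" using frag_nonadjacent[OF fr'] unfolding E'_def V'' by auto
    moreover have "nb a \<subseteq> (nb a \<inter> C) \<union> E' `` {a}" using edge_V aV by (auto simp: E'_def V'_def)
    ultimately have "nb a - (X \<union> (Y \<union> nb a \<inter> C)) \<subseteq> E' `` {a} - (X \<union> Y)"
      and XD: "X \<subseteq> nb a \<inter> ?D" "Y \<subseteq> nb a \<inter> ?D" using X by auto
    then have "card (nb a - (X \<union> (Y \<union> nb a \<inter> C))) \<le> 1"
      using X(5) card_mono[of "E' `` {a} - (X \<union> Y)"] finite_subset[OF _ finite_nb[of a]]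
      by (meson \<open>E' `` {a} \<subseteq> nb a \<inter> opp x y C\<close> finite_Diff inf.boundedE le_trans)
    moreover have "Y \<union> nb a \<inter> C \<noteq> {}" "X \<inter> (Y \<union> nb a \<inter> C) = {}" "X \<union> (Y \<union> nb a \<inter> C) \<subseteq> nb a"
      using X(2,3) XD by auto
    ultimately obtain p q w where w: "p \<in> X" "q \<in> Y \<union> nb a \<inter> C" "w \<noteq> a" "(p, w) \<in> E" "(q, w) \<in> E"
      using linked[OF aV(2) X(1), of "Y \<union> nb a \<inter> C"] by metis
    have wV: "w \<in> V" using w edge_V by blast
    have "w \<notin> C" using w XD frag_no_edge[OF fr] by blast
    moreover have "q \<notin> C"
    proof
      assume "q \<in> C"
      then have "w \<notin> ?D" using frag_no_edge[OF fr] w by blast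
      then have "w = b" using \<open>w \<notin> C\<close> wV w(3) ab by auto
      then show False using noX w edge_sym by blast
    qed
    ultimately have "w \<in> V'" "p \<in> V'" "q \<in> V'" "q \<in> Y" using w wV XD by (auto simp: V'_def)
    then show ?thesis using w by (auto simp: E'_def)
  qed
  have at_x': "\<exists>p\<in>X. \<exists>q\<in>Y. \<exists>w. w \<noteq> a \<and> (p, w) \<in> E' \<and> (q, w) \<in> E'"
    if ab: "a = x \<and> b = y \<or> a = y \<and> b = x" and X: "X \<noteq> {}" "Y \<noteq> {}" "X \<inter> Y = {}" "X \<union> Y \<subseteq> E' `` {a}"
      "card (E' `` {a} - (X \<union> Y)) \<le> 1" for a b X Y
  proof -
    consider "X \<inter> nb b = {}" | "Y \<inter> nb b = {}" | p q where "p \<in> X \<inter> nb b" "q \<in> Y \<inter> nb b" by blast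
    then show ?thesis
    proof cases
      case 1 then show ?thesis using at_x[OF ab X] by blast
    next
      case 2
      have "Y \<inter> X = {}" "Y \<union> X \<subseteq> E' `` {a}" "card (E' `` {a} - (Y \<union> X)) \<le> 1"
        using X by (auto simp: Un_commute)
      from at_x[OF ab X(2,1) this 2] show ?thesis by blast
    next
      case 3
      then have "p \<in> V'" "q \<in> V'" "b \<in> V'" "b \<noteq> a" using X(4) ab xy by (auto simp: E'_def)
      then have "(p, b) \<in> E'" "(q, b) \<in> E'" using 3 edge_sym by (auto simp: E'_def)
      then show ?thesis using 3 \<open>b \<noteq> a\<close> by blast
    qed
  qed
  show ?thesis
  proof unfold_locales
    show "simple_graph V' E'" "connected_graph V' E'" by fact+
    show "\<exists>c::'a \<Rightarrow> bool. \<forall>u v. (u, v) \<in> E' \<longrightarrow> c u \<noteq> c v"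
      using col_edge by (intro exI[of _ col]) (auto simp: E'_def)
  next
    fix v assume v: "v \<in> V'"
    show "2 \<le> card (E' `` {v})"
    proof (cases "v \<in> ?D")
      case True then show ?thesis using nbD deg_ge_2 by auto
    next
      case False
      then have "{d, d'} \<subseteq> E' `` {v}" using v V' d' by auto
      then have "card {d, d'} \<le> card (E' `` {v})"
        by (intro card_mono) (use finite_subset[of "E' `` {v}" "nb v"] in \<open>auto simp: E'_def\<close>)
      then show ?thesis using dd by simp
    qed
  next
    fix v X Y
    assume v: "v \<in> V'" and X: "X \<noteq> {}" "Y \<noteq> {}" "X \<inter> Y = {}" "X \<union> Y \<subseteq> E' `` {v}"
      "card (E' `` {v} - (X \<union> Y)) \<le> 1"
    show "\<exists>p\<in>X. \<exists>q\<in>Y. \<exists>w. w \<noteq> v \<and> (p, w) \<in> E' \<and> (q, w) \<in> E'"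
    proof (cases "v \<in> ?D")
      case True
      then have "v \<in> V" by simp
      then obtain p q w where w: "p \<in> X" "q \<in> Y" "w \<noteq> v" "(p, w) \<in> E" "(q, w) \<in> E"
        using linked[OF _ X[unfolded nbD[OF True]]] by metis
      have pq: "p \<in> V'" "q \<in> V'" "p \<noteq> q" using X w by (auto simp: E'_def)
      show ?thesis
      proof (cases "w \<in> C")
        \<comment> \<open>The link was deleted, so it joined \<open>x\<close> and \<open>y\<close>.
          One of \<open>d\<close>, \<open>d'\<close> differs from \<open>v\<close> and takes its
          place.\<close>
        case True
        then have "p \<in> {x, y}" "q \<in> {x, y}" using pq w frag_no_edge[OF fr] V' by blast+
        moreover obtain e where "e \<in> {d, d'}" "e \<noteq> v" using dd by blast
        ultimately show ?thesis using w d' by blast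
      next
        case False
        then have "w \<in> V'" using w edge_V by (auto simp: V'_def)
        then show ?thesis using w pq by (auto simp: E'_def)
      qed
    next
      case False
      then have "v = x \<or> v = y" using v V' by blast
      then obtain b where "v = x \<and> b = y \<or> v = y \<and> b = x" by blast
      from at_x'[OF this X] show ?thesis .
    qed
  qed
qed

text \<open>Distance to the set of \<open>x\<close> and \<open>y\<close>. Allowing
  \<open>x = y\<close> lets the same layer lemmas serve for distance sums of a single
  vertex.\<close>

definition \<delta> :: "'a \<Rightarrow> 'a \<Rightarrow> 'a \<Rightarrow> nat" where
  "\<delta> x y u = min (dist E x u) (dist E y u)"

lemma \<delta>_same [simp]: "\<delta> v v = dist E v" by (simp add: \<delta>_def fun_eq_iff)

lemma \<delta>_edge: "x \<in> V \<Longrightarrow> y \<in> V \<Longrightarrow> (u, w) \<in> E \<Longrightarrow> \<delta> x y w \<le> Suc (\<delta> x y u)"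
  using dist_edge_le[of x u w] dist_edge_le[of y u w] by (auto simp: \<delta>_def)

lemma \<delta>_pos: "x \<in> V \<Longrightarrow> y \<in> V \<Longrightarrow> u \<in> V - {x, y} \<Longrightarrow> 1 \<le> \<delta> x y u"
  using dist_eq_0[of x u] dist_eq_0[of y u] by (auto simp: \<delta>_def)

lemma \<delta>_0 [simp]: "\<delta> x y x = 0" "\<delta> x y y = 0" by (auto simp: \<delta>_def)

lemma \<delta>_1: "x \<in> V \<Longrightarrow> y \<in> V \<Longrightarrow> u \<in> V - {x, y} \<Longrightarrow> \<delta> x y u = 1 \<longleftrightarrow> (x, u) \<in> E \<or> (y, u) \<in> E"
  using dist_Suc0[of x u] dist_Suc0[of y u] dist_eq_0[of x u] dist_eq_0[of y u] by (auto simp: \<delta>_def min_def)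

lemma layer_boundary:
  assumes "C \<subseteq> V" "x \<in> V" "y \<in> V" "E `` C \<subseteq> C \<union> {x, y}" "1 \<le> i"
  shows "E `` {u\<in>C. i < \<delta> x y u} \<subseteq> {u\<in>C. i < \<delta> x y u} \<union> {u\<in>C. \<delta> x y u = i}"
proof
  fix w assume "w \<in> E `` {u\<in>C. i < \<delta> x y u}"
  then obtain u where u: "u \<in> C" "i < \<delta> x y u" "(u, w) \<in> E" by auto
  then have "i \<le> \<delta> x y w" using \<delta>_edge[OF assms(2,3) edge_sym[OF u(3)]] by linarith
  moreover have "w \<in> C" using calculation assms(4,5) u by fastforce
  ultimately show "w \<in> {u\<in>C. i < \<delta> x y u} \<union> {u\<in>C. \<delta> x y u = i}" by auto
qed

text \<open>A layer with something beyond it separates that part from \<open>x\<close>, so a layer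
  of one vertex would be a cut vertex.\<close>

lemma layered_2:
  assumes "C \<subseteq> V" "x \<in> V" "y \<in> V" "E `` C \<subseteq> C \<union> {x, y}"
  shows "layered 2 C (\<delta> x y)"
  unfolding layered_def
proof (intro allI impI, rule ccontr)
  fix i :: nat
  let ?A = "{u\<in>C. i < \<delta> x y u}" and ?S = "{u\<in>C. \<delta> x y u = i}"
  assume i: "1 \<le> i" "\<exists>u\<in>C. i < \<delta> x y u" and "\<not> 2 \<le> card ?S"
  then have "V \<subseteq> ?A \<union> ?S"
    using layer_boundary[OF assms i(1)] assms(1) finite_sub[OF assms(1)]
    by (intro two_connected) auto
  then have "x \<in> ?A \<union> ?S" using assms by blast
  then show False using i by auto
qed

text \<open>A layer of exactly two vertices would turn the part beyond it into a fragment properly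
  contained in \<open>C\<close>.\<close>

lemma layered_3:
  assumes "C \<subseteq> V" "x \<in> V" "y \<in> V" "E `` C \<subseteq> C \<union> {x, y}"
    and min: "\<And>r s A. A \<subset> C \<Longrightarrow> \<not> frag r s A"
  shows "layered 3 C (\<delta> x y)"
  unfolding layered_def
proof (intro allI impI, rule ccontr)
  fix i :: nat
  let ?A = "{u\<in>C. i < \<delta> x y u}" and ?S = "{u\<in>C. \<delta> x y u = i}"
  assume i: "1 \<le> i" "\<exists>u\<in>C. i < \<delta> x y u" and "\<not> 3 \<le> card ?S"
  moreover have "2 \<le> card ?S" using layered_2[OF assms(1-4)] i unfolding layered_def by blast
  ultimately have "card ?S = 2" by linarith
  then obtain r s where rs: "?S = {r, s}" "r \<noteq> s" by (auto simp: card_2_iff)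
  then have S: "r \<in> C" "\<delta> x y r = i" "s \<in> C" "\<delta> x y s = i" by auto
  have x: "x \<in> V - ?A - {r, s}" using assms S i by auto
  have "frag r s ?A"
    unfolding frag_def
  proof (intro conjI)
    show "E `` ?A \<subseteq> ?A \<union> {r, s}" using layer_boundary[OF assms(1-4) i(1)] unfolding rs(1) .
    show "?A \<noteq> {}" using i by blast
    show "V - ?A - {r, s} \<noteq> {}" using x by blast
  qed (use S rs assms(1) in auto)
  moreover have "?A \<subset> C" using S by auto
  ultimately show False using min by blast
qed

end

section \<open>Graphs without 2-vertex separations\<close>

definition wbound :: "nat \<Rightarrow> real" where
  "wbound n = (if even n then real n ^ 3 / 12 + 7 / 6 * real n - 2
     else real n ^ 3 / 12 + 11 / 12 * real n - 1)"

definition dist_sum :: "'a set \<Rightarrow> ('a \<times> 'a) set \<Rightarrow> nat" where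
  "dist_sum V E = (\<Sum>u\<in>V. \<Sum>v\<in>V. dist E u v)"

lemma wbound_ge: "4 \<le> n \<Longrightarrow> real n ^ 3 / 12 + 11 / 12 * real n - 1 \<le> wbound n"
  by (simp add: wbound_def)

context linked_graph
begin

section \<open>Distance sums of single vertices\<close>

definition L2 :: "'a \<Rightarrow> 'a set" where "L2 v = {u\<in>V. dist E v u = 2}"

lemma finite_L2 [simp]: "finite (L2 v)" by (simp add: L2_def)

lemma card_V_pos: "v \<in> V \<Longrightarrow> 1 \<le> card V"
  using card_gt_0_iff[of V] finite_V by fastforce

lemma status_layers:
  assumes "v \<in> V"
  shows "finite (V - {v})" "\<forall>u\<in>V - {v}. 1 \<le> dist E v u"
    "layered 2 (V - {v}) (dist E v)"
    "(\<And>r s A. \<not> frag r s A) \<Longrightarrow> layered 3 (V - {v}) (dist E v)"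
    "{u\<in>V - {v}. dist E v u = 1} = nb v" "{u\<in>V - {v}. dist E v u = 2} = L2 v"
    "(\<Sum>u\<in>V. dist E v u) = sum (dist E v) (V - {v})"
proof -
  have E: "E `` (V - {v}) \<subseteq> (V - {v}) \<union> {v, v}" using edge_V by auto
  show "layered 2 (V - {v}) (dist E v)"
    using layered_2[of "V - {v}" v v] E assms by simp
  show "layered 3 (V - {v}) (dist E v)" if "\<And>r s A. \<not> frag r s A"
    using layered_3[of "V - {v}" v v] E assms that by simp
  show "\<forall>u\<in>V - {v}. 1 \<le> dist E v u" using \<delta>_pos[of v v] assms by auto
  show "{u\<in>V - {v}. dist E v u = 1} = nb v" using dist_Suc0[OF assms] edge_V by auto
  show "{u\<in>V - {v}. dist E v u = 2} = L2 v" by (auto simp: L2_def)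
  show "(\<Sum>u\<in>V. dist E v u) = sum (dist E v) (V - {v})"
    using sum.remove[OF finite_V assms, of "dist E v"] by simp
qed simp

lemma status_le:
  assumes "v \<in> V"
  shows "real (\<Sum>u\<in>V. dist E v u) \<le> real (card V) ^ 2 / 4"
proof -
  note L = status_layers[OF assms]
  have "real (sum (dist E v) (V - {v})) \<le> \<phi>\<^sub>2 (card (V - {v}))" by (rule layer_sum2[OF L(1-3)])
  also have "\<dots> = real (card V) ^ 2 / 4"
    using assms card_V_pos[OF assms] by (simp add: \<phi>\<^sub>2_def of_nat_diff)
  finally show ?thesis using L(7) by simp
qed

lemma dist_2:
  assumes "(v, u) \<in> E" "(u, w) \<in> E" "w \<noteq> v"
  shows "dist E v w = 2"
proof -
  have V: "v \<in> V" "w \<in> V" using assms edge_V by auto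
  have "dist E v w \<le> 2" using dist_edge_le[of v u w] dist_edge[OF assms(1)] assms V by simp
  moreover have "dist E v w \<noteq> 0" using V assms by (simp add: dist_eq_0)
  moreover have "(v, w) \<notin> E" using col_edge assms by blast
  then have "dist E v w \<noteq> Suc 0" using V by (simp add: dist_Suc0)
  ultimately show ?thesis by linarith
qed

lemma nb_nb: "u \<in> nb v \<Longrightarrow> nb u \<subseteq> {v} \<union> L2 v"
  using dist_2 edge_V by (fastforce simp: L2_def)

lemma nb_L2_disjoint: "nb v \<inter> L2 v = {}"
  using dist_edge by (fastforce simp: L2_def)

lemma double_count:
  assumes "finite A" "finite B"
  shows "(\<Sum>a\<in>A. card (nb a \<inter> B)) = (\<Sum>b\<in>B. card (nb b \<inter> A))"
proof -
  have *: "card (nb a \<inter> B) = (\<Sum>b\<in>B. of_bool ((a, b) \<in> E))" if "finite B" for a B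
    using that by (simp add: sum.If_cases of_bool_def Int_commute Collect_conj_eq[symmetric] Image_singleton Int_def)
  have "(\<Sum>a\<in>A. card (nb a \<inter> B)) = (\<Sum>a\<in>A. \<Sum>b\<in>B. of_bool ((a, b) \<in> E))" using * assms by simp
  also have "\<dots> = (\<Sum>b\<in>B. \<Sum>a\<in>A. of_bool ((b, a) \<in> E))"
    by (subst sum.swap, intro sum.cong refl arg_cong[of _ _ of_bool]) (use edge_sym in blast)
  also have "\<dots> = (\<Sum>b\<in>B. card (nb b \<inter> A))" using * assms by simp
  finally show ?thesis .
qed

lemma three_connected:
  assumes nofrag: "\<And>r s A. \<not> frag r s A"
    and A: "A \<subseteq> V" "A \<noteq> {}" "A \<inter> S = {}" and S: "finite S" "card S \<le> 2" and cl: "E `` A \<subseteq> A \<union> S"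
  shows "V \<subseteq> A \<union> S"
proof -
  have cl': "E `` A \<subseteq> A \<union> (S \<inter> V)" using cl edge_V by blast
  have le: "card (S \<inter> V) \<le> 2" using S card_mono[of S "S \<inter> V"] by simp
  show ?thesis
  proof (cases "card (S \<inter> V) \<le> 1")
    case True
    then show ?thesis using two_connected[of A "S \<inter> V"] A cl' S by blast
  next
    case False
    then have "card (S \<inter> V) = 2" using le by linarith
    then obtain r s where rs: "S \<inter> V = {r, s}" "r \<noteq> s" by (auto simp: card_2_iff)
    then have "r \<in> V" "s \<in> V" "r \<notin> A" "s \<notin> A" using A(3) by blast+
    then have "frag r s A" if "V - A - {r, s} \<noteq> {}"
      using that A(1,2) cl' rs(2) unfolding rs(1) by (simp only: frag_def) simp
    then have "V - A - {r, s} = {}" using nofrag by blast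
    then show ?thesis using rs by blast
  qed
qed

lemma card_le_of_cover: "V \<subseteq> A \<Longrightarrow> finite A \<Longrightarrow> card A \<le> k \<Longrightarrow> card V \<le> k"
  using card_mono le_trans by blast

lemma status_le3:
  assumes nofrag: "\<And>r s A. \<not> frag r s A" and v: "v \<in> V"
  shows "real (\<Sum>u\<in>V. dist E v u) \<le> real (card V) * (real (card V) + 1) / 6"
proof -
  note L = status_layers[OF v]
  have "real (sum (dist E v) (V - {v})) \<le> \<phi>\<^sub>3 (card (V - {v}))" by (rule layer_sum3[OF L(1,2) L(4)[OF nofrag]])
  also have "\<dots> = real (card V) * (real (card V) + 1) / 6"
    using v card_V_pos[OF v] by (simp add: \<phi>\<^sub>3_def of_nat_diff)
  finally show ?thesis using L(7) by simp
qed

text \<open>The saving over \<open>status_le3\<close> is \<open>(n - 6) / 3\<close>. The constant 12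
  is what layers of sizes 3, 4, 3, 3, and so on require.\<close>

lemma status_le3_improved:
  assumes nofrag: "\<And>r s A. \<not> frag r s A" and v: "v \<in> V" and n: "10 \<le> card V"
    and alt: "4 \<le> card (nb v) \<or> 3 \<le> card (nb v) \<and> 4 \<le> card (L2 v)"
  shows "real (\<Sum>u\<in>V. dist E v u) \<le> (real (card V) ^ 2 - real (card V) + 12) / 6"
proof -
  note L = status_layers[OF v]
  have c: "card (V - {v}) = card V - 1" using v by simp
  show ?thesis using alt
  proof
    assume "4 \<le> card (nb v)"
    then have "real (sum (dist E v) (V - {v})) \<le> real (card (V - {v})) + \<phi>\<^sub>3 (card (V - {v}) - 4)"
      using layer_sum3_first[OF L(1,2) L(4)[OF nofrag]] L(5) by simp
    then show ?thesis unfolding c L(7) using n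
      by (simp add: \<phi>\<^sub>3_def of_nat_diff power2_eq_square field_simps)
  next
    assume "3 \<le> card (nb v) \<and> 4 \<le> card (L2 v)"
    then have "real (sum (dist E v) (V - {v})) \<le> real (card (V - {v})) + real (card (V - {v}) - 3)
        + \<phi>\<^sub>3 (card (V - {v}) - 3 - 4)"
      using layer_sum3_second[OF L(1,2) L(4)[OF nofrag], of 3 4] L(5,6) by simp
    then show ?thesis unfolding c L(7) using n
      by (simp add: \<phi>\<^sub>3_def of_nat_diff power2_eq_square field_simps)
  qed
qed

text \<open>Adjacent thin vertices \<open>v\<close> and \<open>a\<close> would make \<open>nb v \<union> nb a\<close> a set with only two boundary
vertices, so the thin vertices are independent; each of them has three neighbours, and no vertex has
more than three thin neighbours.\<close>

lemma few_thin_vertices: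
  assumes nofrag: "\<And>r s A. \<not> frag r s A" and n: "10 \<le> card V"
  defines "T \<equiv> {v\<in>V. card (nb v) = 3 \<and> card (L2 v) \<le> 3}"
  shows "\<forall>v\<in>V. 3 \<le> card (nb v)" and "2 * card T \<le> card V"
proof -
  note conn = three_connected[OF nofrag]
  show deg: "\<forall>v\<in>V. 3 \<le> card (nb v)"
  proof (rule ballI, rule ccontr)
    fix v assume v: "v \<in> V" "\<not> 3 \<le> card (nb v)"
    then have "V \<subseteq> {v} \<union> nb v" by (intro conn) auto
    then have "card V \<le> 3" using v card_insert_le_m1[of 3 "nb v" v] by (intro card_le_of_cover) auto
    then show False using n by simp
  qed
  \<comment> \<open>With at most two vertices at distance 2, \<open>v\<close> and its neighbours
    would have too small a boundary.\<close>
  have L2: "card (L2 v) = 3" if "v \<in> T" for v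
  proof (rule ccontr)
    assume "card (L2 v) \<noteq> 3"
    then have le: "card (L2 v) \<le> 2" using that by (auto simp: T_def)
    have v: "v \<in> V" "card (nb v) = 3" using that by (auto simp: T_def)
    have "V \<subseteq> insert v (nb v) \<union> L2 v"
    proof (rule conn)
      show "insert v (nb v) \<inter> L2 v = {}" using nb_L2_disjoint[of v] by (auto simp: L2_def)
      show "E `` insert v (nb v) \<subseteq> insert v (nb v) \<union> L2 v" using nb_nb by blast
    qed (use v nb_V le in auto)
    moreover have "card (insert v (nb v) \<union> L2 v) \<le> 6"
      using card_Un_le[of "insert v (nb v)" "L2 v"] le v card_insert_le_m1[of 4 "nb v" v] by simp
    ultimately have "card V \<le> 6" by (intro card_le_of_cover) auto
    then show False using n by simp
  qed
  have indep: "a \<notin> T" if "v \<in> T" "(v, a) \<in> E" for v a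
  proof
    assume "a \<in> T"
    let ?A = "nb v \<union> nb a" and ?S = "(L2 v - nb a) \<union> (L2 a - nb v)"
    have va: "card (nb v) = 3" "card (nb a) = 3" "(a, v) \<in> E"
      using \<open>v \<in> T\<close> \<open>a \<in> T\<close> that(2) edge_sym by (auto simp: T_def)
    \<comment> \<open>The other two neighbours of \<open>a\<close> are at distance 2 from
      \<open>v\<close>, so at most one of the three vertices of \<open>L2 v\<close> lies outside
      \<open>nb a\<close>.\<close>
    have half: "card (L2 v - nb a) \<le> 1" if "v \<in> T" "(v, a) \<in> E" "card (nb a) = 3" for v a
    proof -
      have "nb a - {v} \<subseteq> L2 v \<inter> nb a" using nb_nb[of a v] that(2) by blast
      then have "card (nb a - {v}) \<le> card (L2 v \<inter> nb a)" by (intro card_mono) auto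
      moreover have "card (nb a - {v}) = 2" using that edge_sym by (subst card_Diff_singleton) auto
      moreover have "card (L2 v) = card (L2 v \<inter> nb a) + card (L2 v - nb a)"
        by (rule card_Int_Diff) simp
      ultimately show ?thesis using L2[OF that(1)] by linarith
    qed
    have S: "card ?S \<le> 2"
      using card_Un_le[of "L2 v - nb a" "L2 a - nb v"] half[OF that va(2)] half[OF \<open>a \<in> T\<close> va(3) va(1)] by linarith
    have "V \<subseteq> ?A \<union> ?S"
    proof (rule conn)
      show "?A \<noteq> {}" using that by blast
      show "?A \<inter> ?S = {}" using nb_L2_disjoint by blast
      show "E `` ?A \<subseteq> ?A \<union> ?S" using nb_nb that(2) va(3) by blast
    qed (use nb_V S in auto)
    moreover have "card (?A \<union> ?S) \<le> 8"
      using card_Un_le[of ?A ?S] card_Un_le[of "nb v" "nb a"] S va by linarith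
    ultimately have "card V \<le> 8" by (intro card_le_of_cover) auto
    then show False using n by simp
  qed
  \<comment> \<open>With four thin neighbours, \<open>nb a\<close> equals
    \<open>{u} \<union> L2 u\<close> for each of its members \<open>u\<close>. Then
    \<open>nb a\<close> and the set \<open>R\<close> of its neighbours make up the whole graph, and
    counting edges between them gives \<open>3 * card R \<le> 12\<close>, so there are at most 8
    vertices.\<close>
  have nbT: "card (nb a \<inter> T) \<le> 3" for a
  proof (rule ccontr)
    assume big: "\<not> card (nb a \<inter> T) \<le> 3"
    then have "nb a \<inter> T \<noteq> {}" by (metis card.empty zero_le)
    then obtain v where v: "v \<in> nb a" "v \<in> T" by blast
    have nba: "nb a \<subseteq> {v} \<union> L2 v" if "v \<in> nb a" for v using nb_nb[of a v] that edge_sym by blast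
    have "card (nb a) \<le> card ({v} \<union> L2 v)" using nba[OF v(1)] by (intro card_mono) auto
    also have "\<dots> \<le> 4" using card_Un_le[of "{v}" "L2 v"] L2[OF v(2)] by simp
    finally have c4: "card (nb a) \<le> 4" .
    have "nb a \<inter> T = nb a" by (rule card_seteq) (use big c4 in auto)
    then have allT: "u \<in> T" if "u \<in> nb a" for u using that by blast
    have c4': "card (nb a) = 4" using big c4 \<open>nb a \<inter> T = nb a\<close> by simp
    have L2eq: "L2 u \<subseteq> nb a" if "u \<in> nb a" for u
    proof -
      have "nb a - {u} = L2 u"
        by (rule card_seteq) (use nba[OF that] L2[OF allT[OF that]] c4' that in auto)
      then show ?thesis by blast
    qed
    define R where "R = (\<Union>u\<in>nb a. nb u)"
    have R: "R \<subseteq> V" "finite R" using nb_V by (auto simp: R_def)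
    have nbR: "nb r \<subseteq> nb a" if "r \<in> R" for r
      using that nb_nb[of r] L2eq unfolding R_def by blast
    have "nb a \<union> R = V"
    proof (rule closed_eq_V)
      show "E `` (nb a \<union> R) \<subseteq> nb a \<union> R" using nbR by (auto simp: R_def)
    qed (use nb_V R v in auto)
    then have nR: "card V \<le> 4 + card R" using card_Un_le[of "nb a" R] c4' by simp
    have "3 * card R = (\<Sum>r\<in>R. 3)" by simp
    also have "\<dots> \<le> (\<Sum>r\<in>R. card (nb r \<inter> nb a))"
    proof (rule sum_mono)
      fix r assume "r \<in> R"
      then have "nb r \<inter> nb a = nb r" "r \<in> V" using nbR R by auto
      then show "3 \<le> card (nb r \<inter> nb a)" using deg by simp
    qed
    also have "\<dots> = (\<Sum>u\<in>nb a. card (nb u \<inter> R))" using R by (intro double_count) auto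
    also have "\<dots> \<le> (\<Sum>u\<in>nb a. 3)"
    proof (rule sum_mono)
      fix u assume "u \<in> nb a"
      then have "card (nb u) = 3" using allT by (simp add: T_def)
      then show "card (nb u \<inter> R) \<le> 3" using card_mono[of "nb u" "nb u \<inter> R"] by simp
    qed
    also have "\<dots> = 12" using c4' by simp
    finally show False using nR n by simp
  qed
  have fT: "finite T" "T \<subseteq> V" by (auto simp: T_def)
  have "3 * card T = (\<Sum>v\<in>T. card (nb v \<inter> (V - T)))"
  proof -
    have "card (nb v \<inter> (V - T)) = 3" if "v \<in> T" for v
    proof -
      have "nb v \<inter> (V - T) = nb v" using indep that nb_V by blast
      then show ?thesis using that by (simp add: T_def)
    qed
    then show ?thesis by simp
  qed
  also have "\<dots> = (\<Sum>b\<in>V - T. card (nb b \<inter> T))" using fT by (intro double_count) auto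
  also have "\<dots> \<le> (\<Sum>b\<in>V - T. 3)" by (intro sum_mono nbT)
  also have "\<dots> = 3 * (card V - card T)" using fT by (simp add: card_Diff_subset)
  finally show "2 * card T \<le> card V" by linarith
qed

text \<open>The uniform bound \<open>status_le3\<close> suffices exactly up to 9 vertices. From 10
  on, the improved bound for at least half of the vertices brings the total down to
  \<open>n^3 / 6 + n\<close>.\<close>

lemma dist_sum_no_frag:
  assumes nofrag: "\<And>r s A. \<not> frag r s A" and n4: "4 \<le> card V"
  shows "real (dist_sum V E) \<le> 2 * wbound (card V)"
proof -
  let ?n = "real (card V)"
  have ds: "real (dist_sum V E) = (\<Sum>v\<in>V. real (\<Sum>u\<in>V. dist E v u))" by (simp add: dist_sum_def)
  have goal: "?thesis" if "real (dist_sum V E) \<le> ?n ^ 3 / 6 + 11 / 6 * ?n - 2"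
    using that wbound_ge[OF n4] by simp
  show ?thesis
  proof (cases "card V \<le> 9")
    case True
    have "real (dist_sum V E) \<le> (\<Sum>v\<in>V. ?n * (?n + 1) / 6)"
      unfolding ds by (intro sum_mono status_le3 nofrag)
    also have "\<dots> = ?n ^ 3 / 6 + 11 / 6 * ?n - 2 + ((?n - 9) * (?n - 2) - 6) / 6"
      by (simp add: power3_eq_cube field_simps)
    also have "\<dots> \<le> ?n ^ 3 / 6 + 11 / 6 * ?n - 2"
      using mult_nonneg_nonneg[of "9 - ?n" "?n - 2"] True n4 by (simp add: algebra_simps)
    finally show ?thesis by (rule goal)
  next
    case False
    then have n: "10 \<le> card V" by simp
    define T where "T = {v\<in>V. card (nb v) = 3 \<and> card (L2 v) \<le> 3}"
    have T: "T \<subseteq> V" "finite T" by (auto simp: T_def)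
    note few = few_thin_vertices[OF nofrag n]
    have t: "2 * real (card T) \<le> ?n" using few(2) unfolding T_def[symmetric] by linarith
    have "real (dist_sum V E) = (\<Sum>v\<in>T. real (\<Sum>u\<in>V. dist E v u)) + (\<Sum>v\<in>V - T. real (\<Sum>u\<in>V. dist E v u))"
      unfolding ds using T by (subst sum.subset_diff[of T V]) auto
    also have "\<dots> \<le> (\<Sum>v\<in>T. ?n * (?n + 1) / 6) + (\<Sum>v\<in>V - T. (?n ^ 2 - ?n + 12) / 6)"
    proof (intro add_mono sum_mono)
      fix v assume "v \<in> T"
      then show "real (\<Sum>u\<in>V. dist E v u) \<le> ?n * (?n + 1) / 6" using T by (intro status_le3 nofrag) auto
    next
      fix v assume v: "v \<in> V - T"
      then have "3 \<le> card (nb v)" "card (nb v) \<noteq> 3 \<or> \<not> card (L2 v) \<le> 3" using few(1) by (auto simp: T_def)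
      then show "real (\<Sum>u\<in>V. dist E v u) \<le> (?n ^ 2 - ?n + 12) / 6"
        using v by (intro status_le3_improved nofrag n) auto
    qed
    also have "\<dots> = real (card T) * (?n * (?n + 1) / 6) + (?n - real (card T)) * ((?n ^ 2 - ?n + 12) / 6)"
      using T card_mono[OF finite_V T(1)] by (simp add: card_Diff_subset of_nat_diff)
    also have "\<dots> = ?n * (?n ^ 2 - ?n + 12) / 6 + 2 * real (card T) * (?n - 6) / 6"
      by (simp add: power2_eq_square field_simps)
    also have "\<dots> \<le> ?n * (?n ^ 2 - ?n + 12) / 6 + ?n * (?n - 6) / 6"
      using t n by (intro add_left_mono divide_right_mono mult_right_mono) auto
    also have "\<dots> = ?n ^ 3 / 6 + ?n" by (simp add: power2_eq_square power3_eq_cube field_simps)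
    also have "\<dots> \<le> ?n ^ 3 / 6 + 11 / 6 * ?n - 2" using n by simp
    finally show ?thesis by (rule goal)
  qed
qed

end

section \<open>Cutting along a 2-vertex separation\<close>

text \<open>The right side is the budget for pairs across a separation with sides of sizes
  \<open>a\<close> and \<open>b\<close>, where both smaller graphs contain the two separating
  vertices. The final 2 on the right is the distance of these vertices, counted in both parts. The
  term \<open>1 - b / 4\<close> is exact for odd \<open>a\<close> and even \<open>b\<close>,
  whichever is larger; in the other parities the assumption \<open>a \<le> b\<close> makes it a
  lower estimate.\<close>

lemma wbound_split:
  fixes a b :: nat
  assumes "2 \<le> a" "a \<le> b \<or> odd a \<and> even b"
  shows "real a * real b * (real a + real b) / 4 + real a * real b + 1 - real b / 4
    \<le> wbound (a + b + 2) - wbound (a + 2) - wbound (b + 2) + 2"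
proof -
  have "real (a + b + 2) ^ 3 - real (a + 2) ^ 3 - real (b + 2) ^ 3
      = 3 * real a * real b * (real a + real b) + 12 * real a * real b - 8"
    by (simp add: power3_eq_cube algebra_simps)
  then show ?thesis using assms
    by (cases "even a"; cases "even b") (auto simp: wbound_def field_simps)
qed

text \<open>The strong induction hypothesis as a predicate that the case lemmas can assume; the
  \<open>itself\<close> argument fixes the vertex type.\<close>

definition wiener_below :: "'a itself \<Rightarrow> nat \<Rightarrow> bool" where
  "wiener_below _ n \<longleftrightarrow> (\<forall>(V :: 'a set) E. linked_graph V E \<longrightarrow> 4 \<le> card V \<longrightarrow> card V < n \<longrightarrow>
     real (dist_sum V E) \<le> 2 * wbound (card V))"

context linked_graph
begin

abbreviation DS :: "'a set \<Rightarrow> 'a set \<Rightarrow> nat" where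
  "DS A B \<equiv> (\<Sum>u\<in>A. \<Sum>v\<in>B. dist E u v)"

lemma DS_sym: "DS A B = DS B A"
  by (subst sum.swap) (simp add: dist_sym)

lemma DS_Un:
  assumes "finite A" "finite B" "A \<inter> B = {}"
  shows "DS (A \<union> B) (A \<union> B) = DS A A + 2 * DS A B + DS B B"
  using assms DS_sym[of A B] by (simp add: sum.union_disjoint sum.distrib)

lemma DS_frag_side:
  assumes fr: "frag x y C" and D: "2 \<le> card (opp x y C)" and IH: "wiener_below TYPE('a) (card V)"
  shows "real (DS (V - C) (V - C)) \<le> 2 * wbound (card (V - C))"
proof -
  let ?V = "V - C" and ?E = "E \<inter> (V - C) \<times> (V - C)"
  have lg: "linked_graph ?V ?E" by (rule frag_delete[OF fr D])
  then have cg: "conn_graph ?V ?E" by (simp add: linked_graph_def)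
  have eq: "?V = opp x y C \<union> {x, y}" using fr by (auto simp: frag_def)
  have "card ?V = card (opp x y C \<union> {x, y})" by (rule arg_cong[OF eq])
  also have "\<dots> = card (opp x y C) + card {x, y}"
    by (rule card_Un_disjoint) auto
  finally have "card ?V = card (opp x y C) + card {x, y}" .
  then have "4 \<le> card ?V" using D fr by (simp add: frag_def)
  moreover have "card ?V < card V" using fr by (intro psubset_card_mono) (auto simp: frag_def)
  ultimately have "real (dist_sum ?V ?E) \<le> 2 * wbound (card ?V)"
    using IH lg unfolding wiener_below_def by blast
  moreover have "DS ?V ?V \<le> dist_sum ?V ?E"
    unfolding dist_sum_def by (intro sum_mono dist_le_subgraph[OF _ cg]) auto
  ultimately show ?thesis by linarith
qed

text \<open>The two parts overlap in \<open>x\<close> and \<open>y\<close>. These are at distance 2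
  and are counted as two ordered pairs, hence the 4.\<close>

lemma DS_bulk:
  assumes fr: "frag x y C" and C: "2 \<le> card C" and D: "2 \<le> card (opp x y C)"
    and IH: "wiener_below TYPE('a) (card V)"
  shows "real (dist_sum V E) + 4 \<le> 2 * wbound (card C + 2) + 2 * wbound (card (opp x y C) + 2)
    + 2 * real (DS C (opp x y C))"
    and "card V = card C + card (opp x y C) + 2"
proof -
  define D where "D = opp x y C"
  let ?S = "{x, y}"
  have xy: "x \<noteq> y" "x \<notin> C" "y \<notin> C" and CV: "C \<subseteq> V" "x \<in> V" "y \<in> V" using fr by (auto simp: frag_def)
  have fin: "finite C" "finite D" using CV finite_sub by (auto simp: D_def)
  have disj: "C \<inter> D = {}" "?S \<inter> D = {}" by (auto simp: D_def)
  have eqs: "V - C = ?S \<union> D" "V - D = C \<union> ?S" "V = C \<union> ?S \<union> D" using xy CV by (auto simp: D_def)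
  have cC: "card (V - C) = card D + 2" unfolding eqs(1) using fin xy disj by (subst card_Un_disjoint) auto
  have cD: "card (V - D) = card C + 2" unfolding eqs(2) using fin xy disj by (subst card_Un_disjoint) auto
  have 1: "real (DS (V - C) (V - C)) \<le> 2 * wbound (card D + 2)"
    using DS_frag_side[OF fr D IH] unfolding cC .
  have 2: "real (DS (V - D) (V - D)) \<le> 2 * wbound (card C + 2)"
    using DS_frag_side[OF frag_opp(1)[OF fr] _ IH, unfolded frag_opp(2)[OF fr], OF C] unfolding D_def[symmetric] cD .
  have S: "DS ?S ?S = 4" using frag_dist[OF fr] frag_dist[OF frag_commute[OF fr]] xy by simp
  have 3: "DS (V - C) (V - C) = DS ?S ?S + 2 * DS ?S D + DS D D"
    unfolding eqs(1) by (rule DS_Un) (use fin disj in auto)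
  have 4: "DS (V - D) (V - D) = DS C C + 2 * DS C ?S + DS ?S ?S"
    unfolding eqs(2) by (rule DS_Un) (use fin xy disj in auto)
  have "DS V V = DS (C \<union> ?S \<union> D) (C \<union> ?S \<union> D)" using eqs(3) by simp
  also have "\<dots> = DS (C \<union> ?S) (C \<union> ?S) + 2 * DS (C \<union> ?S) D + DS D D"
    by (rule DS_Un) (use fin disj in auto)
  also have "DS (C \<union> ?S) D = DS C D + DS ?S D"
    by (rule sum.union_disjoint) (use fin xy disj in auto)
  finally have "DS V V + 4 = DS (V - C) (V - C) + DS (V - D) (V - D) + 2 * DS C D"
    using 3 4 S eqs(2) by simp
  then show "real (dist_sum V E) + 4 \<le> 2 * wbound (card C + 2) + 2 * wbound (card (opp x y C) + 2)
      + 2 * real (DS C (opp x y C))"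
    unfolding dist_sum_def D_def[symmetric] using 1 2 by linarith
  have "card V = card C + card (V - C)" using CV fin by (simp add: card_Diff_subset card_mono)
  then show "card V = card C + card (opp x y C) + 2" unfolding D_def[symmetric] using cC by simp
qed

section \<open>Pairs of vertices across a separation\<close>

definition nearer :: "'a \<Rightarrow> 'a \<Rightarrow> 'a set \<Rightarrow> 'a set" where
  "nearer x y A = {u\<in>A. dist E x u < dist E y u}"

lemma DS_cross:
  assumes fr: "frag x y C"
  defines "D \<equiv> opp x y C"
  shows "DS C D \<le> card D * sum (\<delta> x y) C + card C * sum (\<delta> x y) D
    + 2 * (card (nearer x y C) * card (nearer y x D) + card (nearer y x C) * card (nearer x y D))"
proof -
  have V: "x \<in> V" "y \<in> V" "C \<subseteq> V" "D \<subseteq> V" "finite C" "finite D" and xy: "dist E x y = 2"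
    using fr frag_dist[OF fr] finite_sub[of C] by (auto simp: frag_def D_def)
  let ?b = "\<lambda>c z. of_bool (c \<in> nearer x y C) * of_bool (z \<in> nearer y x D)
    + of_bool (c \<in> nearer y x C) * of_bool (z \<in> nearer x y D) :: nat"
  have pair: "dist E c z \<le> \<delta> x y c + \<delta> x y z + 2 * ?b c z" if "c \<in> C" "z \<in> D" for c z
  proof -
    have cz: "c \<in> V" "z \<in> V" using that V by auto
    have "dist E c z \<le> dist E x c + dist E x z" "dist E c z \<le> dist E y c + dist E y z"
      using dist_triangle[of c x z] dist_triangle[of c y z] cz V dist_sym[of c] by auto
    moreover have "dist E y c \<le> dist E x c + 2" "dist E x c \<le> dist E y c + 2"
      using dist_triangle[of y x c] dist_triangle[of x y c] xy dist_sym[of x y] cz V by auto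
    ultimately show ?thesis using that by (auto simp: \<delta>_def nearer_def min_def)
  qed
  have *: "(\<Sum>c\<in>A. \<Sum>z\<in>B. of_bool (c \<in> A') * of_bool (z \<in> B')) = card A' * card B'"
    if "finite A" "finite B" "A' \<subseteq> A" "B' \<subseteq> B" for A B A' B' :: "'a set"
  proof -
    have "(\<Sum>c\<in>A. of_bool (c \<in> A')) = card A'" "(\<Sum>c\<in>B. of_bool (c \<in> B')) = card B'"
      using that by (simp_all add: of_bool_def sum.If_cases Int_absorb1)
    then show ?thesis by (simp add: sum_product[symmetric])
  qed
  have "DS C D \<le> (\<Sum>c\<in>C. \<Sum>z\<in>D. \<delta> x y c + \<delta> x y z + 2 * ?b c z)"
    by (intro sum_mono pair)
  also have "\<dots> = card D * sum (\<delta> x y) C + card C * sum (\<delta> x y) D + 2 * (\<Sum>c\<in>C. \<Sum>z\<in>D. ?b c z)"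
    by (simp only: sum.distrib sum_distrib_left[symmetric] sum_constant) simp
  also have "(\<Sum>c\<in>C. \<Sum>z\<in>D. ?b c z) = card (nearer x y C) * card (nearer y x D)
      + card (nearer y x C) * card (nearer x y D)"
    unfolding sum.distrib using V by (intro arg_cong2[of _ _ _ _ "(+)"] *) (auto simp: nearer_def)
  finally show ?thesis .
qed

lemma frag_layers:
  assumes fr: "frag x y C"
  shows "finite C" "\<forall>u\<in>C. 1 \<le> \<delta> x y u" "layered 2 C (\<delta> x y)"
    "(\<And>r s A. A \<subset> C \<Longrightarrow> \<not> frag r s A) \<Longrightarrow> layered 3 C (\<delta> x y)"
    "{u\<in>C. \<delta> x y u = 1} = C \<inter> (nb x \<union> nb y)"
proof -
  have V: "x \<in> V" "y \<in> V" "C \<subseteq> V" "E `` C \<subseteq> C \<union> {x, y}" "x \<notin> C" "y \<notin> C" using fr by (auto simp: frag_def)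
  show "finite C" using V finite_sub by blast
  show "\<forall>u\<in>C. 1 \<le> \<delta> x y u" using V \<delta>_pos by blast
  show "layered 2 C (\<delta> x y)" by (rule layered_2) fact+
  show "layered 3 C (\<delta> x y)" if "\<And>r s A. A \<subset> C \<Longrightarrow> \<not> frag r s A" by (rule layered_3) fact+
  have "\<delta> x y u = 1 \<longleftrightarrow> (x, u) \<in> E \<or> (y, u) \<in> E" if "u \<in> C" for u
    using \<delta>_1[of x y u] that V by blast
  then show "{u\<in>C. \<delta> x y u = 1} = C \<inter> (nb x \<union> nb y)" by auto
qed

text \<open>If the first layer has only two vertices, they are the common neighbours from
  \<open>frag_two_common\<close>. A shortest path from \<open>x\<close> into \<open>C\<close> that
  avoids \<open>y\<close> thus enters at a neighbour of \<open>y\<close>, from where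
  \<open>y\<close> is as near as \<open>x\<close>.\<close>

lemma balanced:
  assumes fr: "frag x y C" and C: "2 \<le> card C" and c2: "card {u\<in>C. \<delta> x y u = 1} \<le> 2"
  shows "nearer x y C = {}"
proof -
  have V: "x \<in> V" "y \<in> V" "C \<subseteq> V" "E `` C \<subseteq> C \<union> {x, y}" "x \<notin> C" "y \<notin> C" using fr by (auto simp: frag_def)
  obtain p p' where p: "p \<noteq> p'" "{p, p'} \<subseteq> C \<inter> nb x \<inter> nb y" using frag_two_common[OF fr C] by blast
  have "{p, p'} = C \<inter> (nb x \<union> nb y)"
    using c2 p frag_layers(1)[OF fr] unfolding frag_layers(5)[OF fr] by (intro card_seteq) auto
  then have common: "(y, u) \<in> E" if "u \<in> C" "(x, u) \<in> E" for u using that p by blast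
  have "u \<in> C \<Longrightarrow> dist E x u = k \<Longrightarrow> k \<le> dist E y u \<Longrightarrow> dist E y u = k" for u k
  proof (induction k arbitrary: u)
    case 0
    then show ?case using V dist_eq_0[of x u] by auto
  next
    case (Suc k)
    have uV: "u \<in> V" using Suc.prems V by blast
    obtain w where w: "(w, u) \<in> E" "dist E x w = k" using dist_pred[OF V(1) uV] Suc.prems by blast
    show ?case
    proof (cases "w \<in> C")
      case True
      have "k \<le> dist E y w" using dist_edge_le[OF V(2) w(1)] Suc.prems by simp
      then have "dist E y w = k" using Suc.IH[OF True w(2)] by simp
      then show ?thesis using dist_edge_le[OF V(2) w(1)] Suc.prems by simp
    next
      case False
      then have "w = x \<or> w = y" using V(4) Suc.prems(1) edge_sym[OF w(1)] by blast
      then show ?thesis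
      proof
        assume "w = x"
        then have "dist E y u = 1" using common Suc.prems(1) w(1) dist_edge by simp
        then show ?thesis using Suc.prems w \<open>w = x\<close> by simp
      next
        assume "w = y"
        then have "dist E y u = 1" "k = 2" using w dist_edge frag_dist[OF fr] by auto
        then show ?thesis using Suc.prems by simp
      qed
    qed
  qed
  then show ?thesis unfolding nearer_def by (auto simp: less_imp_le) (metis less_imp_le less_irrefl)
qed

text \<open>If at most three vertices of \<open>C\<close> were not strictly nearer to \<open>x\<close>, those nearer to \<open>x\<close> would be
cut off by \<open>x\<close> and a single further vertex, contradicting the minimality of \<open>C\<close>.\<close>

lemma nearer_small:
  assumes fr: "frag x y C" and C: "2 \<le> card C" and deg: "\<forall>v\<in>V. 3 \<le> card (nb v)"
    and min: "\<And>r s A. A \<subset> C \<Longrightarrow> \<not> frag r s A"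
  shows "3 \<le> card C" "nearer x y C = {} \<or> card (nearer x y C) + 4 \<le> card C"
proof -
  have V: "x \<in> V" "y \<in> V" "x \<noteq> y" "C \<subseteq> V" "E `` C \<subseteq> C \<union> {x, y}" "x \<notin> C" "y \<notin> C" using fr by (auto simp: frag_def)
  have fin: "finite C" using V finite_sub by blast
  obtain p p' where pp: "p \<noteq> p'" "{p, p'} \<subseteq> C \<inter> nb x \<inter> nb y" using frag_two_common[OF fr C] by blast
  let ?U = "nearer x y C"
  have pU: "p \<in> C - ?U" "p' \<in> C - ?U" using pp dist_edge[of y] dist_edge[of x] by (auto simp: nearer_def)
  \<comment> \<open>Any further neighbour of \<open>p\<close> or \<open>p'\<close> has distance 2
    from both \<open>x\<close> and \<open>y\<close>, so no edge joins \<open>p\<close> or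
    \<open>p'\<close> to \<open>?U\<close>. Degree at least 3 provides such a neighbour
    \<open>w\<close>.\<close>
  have nbp: "w \<in> C - ?U - {p, p'}" if "w \<in> nb q - {x, y}" "q \<in> {p, p'}" for w q
  proof -
    have q: "q \<in> C" "(x, q) \<in> E" "(y, q) \<in> E" "(q, w) \<in> E" using that pp by auto
    then have "w \<in> C" using that V(5) by blast
    moreover have "dist E x w = 2" "dist E y w = 2" using q that dist_2 by blast+
    moreover have "w \<noteq> p" "w \<noteq> p'" using calculation(2) dist_edge[of x] pp by auto
    ultimately show ?thesis by (simp add: nearer_def)
  qed
  have "\<not> nb p \<subseteq> {x, y}"
  proof
    assume "nb p \<subseteq> {x, y}"
    then have "card (nb p) \<le> card {x, y}" by (intro card_mono) auto
    moreover have "3 \<le> card (nb p)" using deg pp V by auto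
    ultimately show False using V by simp
  qed
  then obtain w where w: "w \<in> nb p - {x, y}" by blast
  then have wU: "w \<in> C - ?U - {p, p'}" using nbp[of w p] by blast
  have "card {p, p', w} \<le> card C" using pp wU fin by (intro card_mono) auto
  moreover have "card {p, p', w} = 3" using pp wU by auto
  ultimately show "3 \<le> card C" by simp
  have UC: "?U \<subseteq> C" by (auto simp: nearer_def)
  show "?U = {} \<or> card ?U + 4 \<le> card C"
  proof (rule ccontr)
    assume not: "\<not> ?thesis"
    have cd: "card C = card ?U + card (C - ?U)" using UC fin by (metis card_Diff_subset card_mono finite_subset le_add_diff_inverse)
    have N: "{p, p', w} = C - ?U"
      by (rule card_seteq) (use fin pU wU not cd \<open>card {p, p', w} = 3\<close> in auto)
    have "E `` ?U \<subseteq> ?U \<union> {x, w}"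
    proof
      fix v assume "v \<in> E `` ?U"
      then obtain u where u: "u \<in> ?U" "(u, v) \<in> E" by blast
      then have uC: "u \<in> C" using UC by blast
      have "v \<noteq> y"
      proof
        assume "v = y"
        then have "dist E x u < 1" using u dist_edge[OF edge_sym[OF u(2)]] by (auto simp: nearer_def)
        then show False using dist_eq_0[of x u] V uC by auto
      qed
      moreover have "v \<noteq> p" "v \<noteq> p'" using nbp[of u v] u uC V edge_sym by blast+
      moreover have "v \<in> C \<union> {x, y}" using V uC u by blast
      ultimately show "v \<in> ?U \<union> {x, w}" using N by blast
    qed
    moreover have "y \<in> V - ?U - {x, w}" using V UC wU by blast
    moreover have "w \<in> V" "x \<noteq> w" "x \<notin> ?U" "w \<notin> ?U" "?U \<subseteq> V" using V wU UC by blast+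
    ultimately have "frag x w ?U" using not V(1) unfolding frag_def by blast
    moreover have "?U \<subset> C" using UC wU by blast
    ultimately show False using min by blast
  qed
qed

lemma nearer_opp:
  assumes "frag x y C" "2 \<le> card C"
  shows "card (nearer x y C) + card (nearer y x C) + 2 \<le> card C"
proof -
  have fin: "finite C" using assms(1) finite_sub by (auto simp: frag_def)
  obtain p p' where pp: "p \<noteq> p'" "{p, p'} \<subseteq> C \<inter> nb x \<inter> nb y" using frag_two_common[OF assms] by blast
  then have d: "dist E x p = 1" "dist E y p = 1" "dist E x p' = 1" "dist E y p' = 1" using dist_edge by auto
  let ?X = "nearer x y C" and ?Y = "nearer y x C"
  have fX: "finite ?X" "finite ?Y" using fin by (auto simp: nearer_def)
  have "card (?X \<union> ?Y \<union> {p, p'}) = card (?X \<union> ?Y) + card {p, p'}"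
    using fX d by (intro card_Un_disjoint) (auto simp: nearer_def)
  also have "card (?X \<union> ?Y) = card ?X + card ?Y"
    using fX by (intro card_Un_disjoint) (auto simp: nearer_def)
  finally have "card ?X + card ?Y + 2 = card (?X \<union> ?Y \<union> {p, p'})" using pp by simp
  also have "\<dots> \<le> card C" using fin pp by (intro card_mono) (auto simp: nearer_def)
  finally show ?thesis .
qed

lemma bulk_case:
  assumes fr: "frag x y C" and C: "2 \<le> card C" and D: "2 \<le> card (opp x y C)"
    and IH: "wiener_below TYPE('a) (card V)"
    and par: "card C \<le> card (opp x y C) \<or> odd (card C) \<and> even (card (opp x y C))"
    and cross: "real (DS C (opp x y C)) \<le> real (card C) * real (card (opp x y C)) * (real (card C) + real (card (opp x y C))) / 4
      + real (card C) * real (card (opp x y C)) + 1 - real (card (opp x y C)) / 4"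
  shows "real (dist_sum V E) \<le> 2 * wbound (card V)"
  using DS_bulk[OF fr C D IH] wbound_split[OF _ par] C cross by simp

text \<open>\<open>cost\<close> counts the pairs that need the detour. If there are none, layers of
  size 3 in \<open>C\<close> are enough. Otherwise \<open>D\<close> has a first layer of size at
  least 3, which saves about \<open>a * b / 2\<close>, while \<open>nearer_small\<close> and
  \<open>nearer_opp\<close> bound \<open>cost\<close> by \<open>(a - 4) * (b - 2)\<close>.\<close>

lemma bulb_case:
  assumes fr: "frag x y C" and C: "2 \<le> card C" and deg: "\<forall>v\<in>V. 3 \<le> card (nb v)"
    and min: "\<And>r s A. frag r s A \<Longrightarrow> card C \<le> card A" and IH: "wiener_below TYPE('a) (card V)"
  shows "real (dist_sum V E) \<le> 2 * wbound (card V)"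
proof -
  define D where "D = opp x y C"
  have frD: "frag x y D" using frag_opp(1)[OF fr] by (simp add: D_def)
  have CD: "card C \<le> card D" using min[OF frD] .
  have finC: "finite C" using fr finite_sub by (auto simp: frag_def)
  have min': "\<not> frag r s A" if "A \<subset> C" for r s A
    using min[of r s A] psubset_card_mono[OF finC that] by auto
  let ?a = "real (card C)" and ?b = "real (card D)"
  note small = nearer_small[OF fr C deg min'] nearer_small[OF frag_commute[OF fr] C deg min']
  have ab: "3 \<le> ?a" "?a \<le> ?b" using small(1) CD by auto
  have SC: "real (sum (\<delta> x y) C) \<le> (?a + 1) * (?a + 2) / 6"
    using layer_sum3[OF frag_layers(1,2)[OF fr] frag_layers(4)[OF fr min']] by (simp add: \<phi>\<^sub>3_def)
  have SD: "real (sum (\<delta> x y) D) \<le> (?b + 1)\<^sup>2 / 4"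
    using layer_sum2[OF frag_layers(1-3)[OF frD]] by (simp add: \<phi>\<^sub>2_def)
  define cost where "cost = card (nearer x y C) * card (nearer y x D) + card (nearer y x C) * card (nearer x y D)"
  have cr: "real (DS C D) \<le> ?b * real (sum (\<delta> x y) C) + ?a * real (sum (\<delta> x y) D) + 2 * real cost"
    using DS_cross[OF fr] unfolding D_def[symmetric] cost_def[symmetric]
    by (simp flip: of_nat_mult of_nat_add of_nat_sum)
  have bSC: "?b * real (sum (\<delta> x y) C) \<le> ?b * ((?a + 1) * (?a + 2) / 6)" using SC by (intro mult_left_mono) auto
  have "real (DS C D) \<le> ?a * ?b * (?a + ?b) / 4 + ?a * ?b + 1 - ?b / 4"
  proof (cases "cost = 0")
    case True
    have "?a * real (sum (\<delta> x y) D) \<le> ?a * ((?b + 1)\<^sup>2 / 4)" using SD by (intro mult_left_mono) auto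
    then have "real (DS C D) \<le> ?b * ((?a + 1) * (?a + 2) / 6) + ?a * ((?b + 1)\<^sup>2 / 4)"
      using cr bSC True by simp
    also have "\<dots> = ?a * ?b * (?a + ?b) / 4 + ?a * ?b + 1 - ?b / 4
        - (?b * (?a\<^sup>2 - 7) / 12 - ?a / 4 + 1)"
      by (simp add: power2_eq_square field_simps)
    also have "\<dots> \<le> ?a * ?b * (?a + ?b) / 4 + ?a * ?b + 1 - ?b / 4"
    proof -
      have "3 * ?a \<le> ?a * ?a" using ab by (intro mult_right_mono) auto
      then have "3 * (3 * ?a - 7) \<le> ?b * (?a\<^sup>2 - 7)" using ab by (intro mult_mono) (auto simp: power2_eq_square)
      then show ?thesis using ab by argo
    qed
    finally show ?thesis .
  next
    case False
    then have "nearer x y C \<noteq> {} \<or> nearer y x C \<noteq> {}" by (auto simp: cost_def)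
    then have M: "card (nearer x y C) + 4 \<le> card C" "card (nearer y x C) + 4 \<le> card C"
      using small(2,4) by auto
    \<comment> \<open>A smaller first layer would make \<open>D\<close> balanced in both directions,
      and no pair would need the detour.\<close>
    have "card {u\<in>D. \<delta> x y u = 1} > 2"
    proof (rule ccontr)
      assume "\<not> ?thesis"
      then have c2: "card {u\<in>D. \<delta> x y u = 1} \<le> 2" by simp
      have "2 \<le> card D" using C CD by simp
      moreover have "\<delta> y x = \<delta> x y" by (auto simp: \<delta>_def min.commute)
      ultimately have "nearer x y D = {}" "nearer y x D = {}"
        using balanced[OF frD] balanced[OF frag_commute[OF frD]] c2 by auto
      then show False using False by (simp add: cost_def)
    qed
    then have "real (sum (\<delta> x y) D) \<le> ?b + \<phi>\<^sub>2 (card D - 3)"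
      using layer_sum2_first[OF frag_layers(1-3)[OF frD], of 3] by simp
    then have "real (sum (\<delta> x y) D) \<le> ?b\<^sup>2 / 4 + 1"
      using ab by (simp add: \<phi>\<^sub>2_def of_nat_diff power2_eq_square field_simps)
    then have aSD: "?a * real (sum (\<delta> x y) D) \<le> ?a * (?b\<^sup>2 / 4 + 1)" by (intro mult_left_mono) auto
    have "cost \<le> (card C - 4) * card (nearer y x D) + (card C - 4) * card (nearer x y D)"
      unfolding cost_def using M by (intro add_mono mult_right_mono) auto
    also have "\<dots> = (card C - 4) * (card (nearer x y D) + card (nearer y x D))" by (simp add: algebra_simps)
    also have "\<dots> \<le> (card C - 4) * (card D - 2)"
      using nearer_opp[OF frD] C CD by (intro mult_left_mono) auto
    finally have "real cost \<le> real ((card C - 4) * (card D - 2))" by linarith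
    also have "\<dots> = (?a - 4) * (?b - 2)" using M CD C by (simp add: of_nat_diff)
    finally have "real (DS C D) \<le> ?b * ((?a + 1) * (?a + 2) / 6) + ?a * (?b\<^sup>2 / 4 + 1) + 2 * ((?a - 4) * (?b - 2))"
      using cr bSC aSD by simp
    \<comment> \<open>Completing the square in \<open>?a\<close> isolates the slack. Its linear part
      is negative only for \<open>card C = 4\<close>, where the square outweighs it.\<close>
    also have "\<dots> = ?a * ?b * (?a + ?b) / 4 + ?a * ?b + 1 - ?b / 4
        - (?b * ((?a - 9)\<^sup>2 + 8) / 12 + 3 * ?a - 15)"
      by (simp add: power2_eq_square field_simps)
    also have "\<dots> \<le> ?a * ?b * (?a + ?b) / 4 + ?a * ?b + 1 - ?b / 4"
    proof -
      have a4: "4 \<le> card C" using M by simp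
      have "0 \<le> ?b * ((?a - 9)\<^sup>2 + 8) / 12 + 3 * ?a - 15"
      proof (cases "card C = 4")
        case True
        then have "?a = 4" by simp
        then show ?thesis using ab by simp
      next
        case False
        then have "5 \<le> ?a" using a4 by simp
        moreover have "0 \<le> ?b * ((?a - 9)\<^sup>2 + 8) / 12" by (intro divide_nonneg_pos mult_nonneg_nonneg) auto
        ultimately show ?thesis by linarith
      qed
      then show ?thesis by linarith
    qed
    finally show ?thesis .
  qed
  then show ?thesis
    using bulk_case[OF fr C] C CD IH by (simp add: D_def)
qed

end

section \<open>Vertices of degree 2\<close>

text \<open>The increments bound the affordable distance sum of a deleted vertex. For even
  \<open>n\<close> it is the bound of \<open>status_le\<close>; for odd \<open>n\<close>, in
  \<open>wbound_odd\<close>, it is smaller by \<open>n / 2 - 9 / 4\<close>.\<close>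

lemma wbound_even: "even n \<Longrightarrow> 1 \<le> n \<Longrightarrow> wbound n = wbound (n - 1) + real n ^ 2 / 4"
  by (simp add: wbound_def of_nat_diff power2_eq_square power3_eq_cube field_simps)

lemma wbound_odd: "odd n \<Longrightarrow> wbound n = wbound (n - 1) + (real n - 1) ^ 2 / 4 + 2"
  by (cases n) (auto simp: wbound_def power2_eq_square power3_eq_cube field_simps)

context linked_graph
begin

text \<open>The two neighbours of \<open>v\<close> separate \<open>v\<close> from the rest, so
  \<open>{v}\<close> is a fragment; five vertices guarantee two on its opposite side.\<close>

lemma delete_deg_2:
  assumes v: "v \<in> V" "card (nb v) = 2" and n: "5 \<le> card V" and IH: "wiener_below TYPE('a) (card V)"
  shows "real (dist_sum V E) \<le> 2 * wbound (card V - 1) + 2 * real (\<Sum>u\<in>V. dist E v u)"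
proof -
  obtain a b where ab: "nb v = {a, b}" "a \<noteq> b" using v(2) by (auto simp: card_2_iff)
  have "(v, a) \<in> E" "(v, b) \<in> E" using ab(1) by blast+
  then have abV: "a \<in> V" "b \<in> V" "a \<noteq> v" "b \<noteq> v" using edge_V by auto
  have "opp a b {v} = V - {v, a, b}" by auto
  moreover have "card {v, a, b} = 3" using ab abV by auto
  ultimately have c: "card (opp a b {v}) = card V - 3" using v abV by (simp add: card_Diff_subset)
  then have "card (opp a b {v}) \<noteq> 0" using n by simp
  then have "opp a b {v} \<noteq> {}" by (metis card.empty)
  then have fr: "frag a b {v}" using v abV ab unfolding frag_def by auto
  have "real (DS (V - {v}) (V - {v})) \<le> 2 * wbound (card V - 1)"
    using DS_frag_side[OF fr _ IH] c n v by simp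
  moreover have "DS V V = DS {v} {v} + 2 * DS {v} (V - {v}) + DS (V - {v}) (V - {v})"
    using DS_Un[of "{v}" "V - {v}"] v by (simp add: insert_absorb)
  moreover have "DS {v} (V - {v}) = (\<Sum>u\<in>V. dist E v u)" using status_layers(7)[OF v(1)] by simp
  ultimately show ?thesis unfolding dist_sum_def by simp
qed

text \<open>Layers of sizes 2, 3, 2, 2, and so on give exactly the increment
  \<open>(n - 1)^2 / 4 + 2\<close> of odd \<open>n\<close>.\<close>

lemma wide_deg_2:
  assumes v: "v \<in> V" "card (nb v) = 2" "3 \<le> card (L2 v)" and n: "7 \<le> card V" "odd (card V)"
    and IH: "wiener_below TYPE('a) (card V)"
  shows "real (dist_sum V E) \<le> 2 * wbound (card V)"
proof -
  note L = status_layers[OF v(1)]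
  have c: "card (V - {v}) = card V - 1" using v by simp
  have "real (sum (dist E v) (V - {v})) \<le> real (card (V - {v})) + real (card (V - {v}) - 2)
      + \<phi>\<^sub>2 (card (V - {v}) - 2 - 3)"
    using layer_sum2_second[OF L(1-3), of 2 3] L(5,6) v by simp
  then have "real (\<Sum>u\<in>V. dist E v u) \<le> (real (card V) - 1) ^ 2 / 4 + 2"
    unfolding c L(7) using n by (simp add: \<phi>\<^sub>2_def of_nat_diff power2_eq_square field_simps)
  then show ?thesis using delete_deg_2[OF v(1,2) _ IH] n wbound_odd[OF n(2)] by simp
qed

lemma col_dist: "v \<in> V \<Longrightarrow> u \<in> V \<Longrightarrow> col u = (col v = even (dist E v u))"
proof (induction "dist E v u" arbitrary: u)
  case 0
  then show ?case using dist_eq_0[of v u] by auto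
next
  case (Suc k)
  then obtain w where w: "(w, u) \<in> E" "dist E v w = k" using dist_pred by metis
  then have "col w = (col v = even k)" using Suc.hyps(1)[of w] Suc.prems edge_V by auto
  then show ?case using col_edge[OF w(1)] unfolding Suc.hyps(2)[symmetric] by auto
qed

lemma thin_deg_2:
  assumes v: "v \<in> V" "card (nb v) = 2" "card (L2 v) \<le> 2" and n: "7 \<le> card V" "odd (card V)"
    and IH: "wiener_below TYPE('a) (card V)"
  shows "real (dist_sum V E) \<le> 2 * wbound (card V)"
proof -
  define l where "l i = {u\<in>V. dist E v u = i}" for i
  have fl: "finite (l i)" for i by (simp add: l_def)
  have l1: "l 1 = nb v" using dist_Suc0[OF v(1)] edge_V by (auto simp: l_def)
  have l2: "l 2 = L2 v" by (simp add: l_def L2_def)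
  have lay: "2 \<le> card (l i)" if "1 \<le> i" "u \<in> V" "i < dist E v u" for i u
  proof -
    have "{u\<in>V - {v}. dist E v u = i} = l i" using that by (auto simp: l_def)
    moreover have "u \<in> V - {v}" using that by auto
    ultimately show ?thesis using status_layers(3)[OF v(1)] that unfolding layered_def by metis
  qed
  \<comment> \<open>The first layer whose size is not 2. It may be empty, namely when layers of size
    2 exhaust the graph.\<close>
  define t where "t = (LEAST i. 1 \<le> i \<and> card (l i) \<noteq> 2)"
  have "l (Suc (\<Sum>u\<in>V. dist E v u)) = {}"
    unfolding l_def using member_le_sum[of _ V "dist E v"] by force
  then have "\<exists>i. 1 \<le> i \<and> card (l i) \<noteq> 2" by (intro exI[of _ "Suc (\<Sum>u\<in>V. dist E v u)"]) simp
  then have t: "1 \<le> t" "card (l t) \<noteq> 2" unfolding t_def by (metis (mono_tags, lifting) LeastI_ex)+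
  have below: "card (l i) = 2" if "1 \<le> i" "i < t" for i
    using not_less_Least[of i "\<lambda>i. 1 \<le> i \<and> card (l i) \<noteq> 2"] that unfolding t_def by blast
  have "card (L2 v) = 2"
  proof (rule ccontr)
    assume no: "card (L2 v) \<noteq> 2"
    have "V \<subseteq> {v} \<union> nb v \<union> L2 v"
    proof
      fix u assume u: "u \<in> V"
      have "\<not> 2 < dist E v u" using lay[of 2 u] u no v(3) l2 by auto
      then have "dist E v u = 0 \<or> dist E v u = 1 \<or> dist E v u = 2" by linarith
      then show "u \<in> {v} \<union> nb v \<union> L2 v" using u v l1 dist_eq_0[of v u] by (auto simp: L2_def l_def)
    qed
    moreover have "card ({v} \<union> nb v \<union> L2 v) \<le> 5"
      using card_Un_le[of "{v} \<union> nb v" "L2 v"] card_Un_le[of "{v}" "nb v"] v by simp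
    ultimately have "card V \<le> 5" by (intro card_le_of_cover) auto
    then show False using n by simp
  qed
  then have t3: "3 \<le> t" using t v l1 l2 by (metis One_nat_def Suc_1 le_SucE le_zero_eq numeral_3_eq_3 not_less_eq_eq)
  have count: "card {u\<in>V. dist E v u < k} + 1 = 2 * k" if "1 \<le> k" "k \<le> t" for k
    using that
  proof (induction k rule: nat_induct_at_least)
    case base
    have "{u\<in>V. dist E v u < 1} = {v}" using v dist_eq_0[of v] by auto
    then show ?case by simp
  next
    case (Suc k)
    have "{u\<in>V. dist E v u < Suc k} = {u\<in>V. dist E v u < k} \<union> l k" by (auto simp: l_def)
    moreover have "card ({u\<in>V. dist E v u < k} \<union> l k) = card {u\<in>V. dist E v u < k} + card (l k)"
      by (rule card_Un_disjoint) (auto simp: l_def)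
    ultimately show ?case using Suc below[of k] by simp
  qed
  show ?thesis
  proof (cases "l t = {}")
    case True
    have lt: "dist E v u < t" if "u \<in> V" for u
    proof -
      have "\<not> t < dist E v u" using lay[of t u] that t(1) True by auto
      moreover have "dist E v u \<noteq> t" using True that by (auto simp: l_def)
      ultimately show ?thesis by linarith
    qed
    have "card (l (t - 1)) = 2" using below[of "t - 1"] t3 by simp
    then obtain u u' where u: "l (t - 1) = {u, u'}" "u \<noteq> u'" by (auto simp: card_2_iff)
    \<comment> \<open>Bipartiteness forbids edges inside the last layer, so its vertices have all
      neighbours in the layer before. That layer has two vertices, and degree at least 2 forces
      equality.\<close>
    have nb_last: "nb w = l (t - 2)" if "w \<in> l (t - 1)" for w
    proof -
      have w: "w \<in> V" "dist E v w = t - 1" using that by (auto simp: l_def)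
      have "nb w \<subseteq> l (t - 2)"
      proof
        fix z assume "z \<in> nb w"
        then have wz: "(w, z) \<in> E" "z \<in> V" using edge_V by auto
        have "dist E v z \<noteq> t - 1"
          using col_dist[OF v(1) w(1)] col_dist[OF v(1) wz(2)] col_edge[OF wz(1)] w(2) by auto
        moreover have "dist E v z < t" using lt wz by blast
        moreover have "t - 1 \<le> Suc (dist E v z)" using dist_edge_le[OF v(1) edge_sym[OF wz(1)]] w by simp
        ultimately show "z \<in> l (t - 2)" using wz(2) unfolding l_def by simp
      qed
      moreover have "card (l (t - 2)) \<le> card (nb w)" using below[of "t - 2"] t3 deg_ge_2[OF w(1)] by simp
      ultimately show ?thesis using fl by (intro card_seteq) auto
    qed
    have uV: "u \<in> V" using u by (auto simp: l_def)
    have nbu: "nb u = l (t - 2)" "nb u' = l (t - 2)" using nb_last u by auto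
    then have cu: "card (nb u) = 2" using below[of "t - 2"] t3 by simp
    show ?thesis
    proof (cases "3 \<le> card (L2 u)")
      case True
      then show ?thesis using wide_deg_2[OF uV cu _ n IH] by simp
    next
      case False
      obtain a where "(u, a) \<in> E" "(u', a) \<in> E" using nbu cu by (metis Image_singleton_iff card.empty ex_in_conv zero_neq_numeral)
      then have u'L: "u' \<in> L2 u" using dist_2[of u a u'] u edge_sym edge_V by (auto simp: L2_def)
      \<comment> \<open>\<open>u\<close> and \<open>u'\<close> have the same neighbours. If at most
        one other vertex is at distance 2 from \<open>u\<close>, it is the whole boundary of
        \<open>?A\<close>, and the graph has at most five vertices.\<close>
      let ?A = "nb u \<union> {u, u'}" and ?S = "L2 u - {u'}"
      have cS: "card ?S \<le> 1" using False u'L by simp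
      have "V \<subseteq> ?A \<union> ?S"
      proof (rule two_connected)
        show "?A \<inter> ?S = {}" using nb_L2_disjoint[of u] by (auto simp: L2_def)
        show "E `` ?A \<subseteq> ?A \<union> ?S" using nb_nb[of _ u] nbu by blast
      qed (use cS uV u'L nb_V in \<open>auto simp: L2_def\<close>)
      moreover have "card (?A \<union> ?S) \<le> 5"
        using card_Un_le[of ?A ?S] card_Un_le[of "nb u" "{u, u'}"] cS cu u by simp
      ultimately have "card V \<le> 5" by (intro card_le_of_cover) auto
      then show ?thesis using n by simp
    qed
  next
    case False
    have big: "3 \<le> card (l t)"
    proof (cases "\<exists>u\<in>V. t < dist E v u")
      case True
      then show ?thesis using lay[of t] t by fastforce
    next
      \<comment> \<open>This is the last layer. With \<open>2 * t - 1\<close> vertices before it and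
        \<open>card V\<close> odd, its size is even, and it is neither 0 nor 2.\<close>
      case no: False
      have "V = {u\<in>V. dist E v u < t} \<union> l t" using no by (force simp: l_def)
      moreover have "card ({u\<in>V. dist E v u < t} \<union> l t) = card {u\<in>V. dist E v u < t} + card (l t)"
        by (rule card_Un_disjoint) (auto simp: l_def)
      ultimately have "card V + 1 = 2 * t + card (l t)" using count[of t] t by simp
      then have "even (card (l t))" using n(2) by presburger
      moreover have "card (l t) \<noteq> 0" using False fl by simp
      ultimately show ?thesis using t(2) by presburger
    qed
    define s where "s = t - 1"
    have s: "2 \<le> s" "t = Suc s" using t3 by (auto simp: s_def)
    have "card (l s) = 2" using below s by simp
    then obtain x y where xy: "l s = {x, y}" "x \<noteq> y" by (auto simp: card_2_iff)
    have xyV: "x \<in> V" "y \<in> V" "dist E v x = s" "dist E v y = s" using xy by (auto simp: l_def)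
    define C where "C = {u\<in>V. dist E v u < s}"
    define D where "D = opp x y C"
    have memD: "u \<in> D \<longleftrightarrow> u \<in> V \<and> s < dist E v u" for u
    proof -
      have "u \<in> {x, y} \<longleftrightarrow> u \<in> V \<and> dist E v u = s" unfolding xy(1)[symmetric] by (simp add: l_def)
      then show ?thesis by (auto simp: D_def C_def)
    qed
    have lD: "l t \<subseteq> D" unfolding l_def s(2) by (auto simp: memD)
    have CE: "E `` C \<subseteq> C \<union> l s"
    proof
      fix w assume "w \<in> E `` C"
      then obtain u where "(u, w) \<in> E" "dist E v u < s" by (auto simp: C_def)
      then show "w \<in> C \<union> l s" using dist_edge_le[OF v(1), of u w] edge_V[of u w] by (auto simp: C_def l_def)
    qed
    have fr: "frag x y C"
      unfolding frag_def
    proof (intro conjI)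
      show "C \<noteq> {}" using v s by (auto simp: C_def)
      show "E `` C \<subseteq> C \<union> {x, y}" using CE unfolding xy(1) .
      show "V - C - {x, y} \<noteq> {}" using lD False unfolding D_def by blast
    qed (use xyV xy(2) in \<open>auto simp: C_def\<close>)
    then have frD: "frag x y D" using frag_opp(1) by (simp add: D_def)
    have finD: "finite D" using frag_layers(1)[OF frD] .
    have cC: "card C + 1 = 2 * s" using count[of s] s by (simp add: C_def)
    have cD3: "3 \<le> card D" using big card_mono[OF finD lD] by simp
    have C2: "2 \<le> card C" using cC s by simp
    have "card V = card C + card D + 2"
      using DS_bulk(2)[OF fr C2 _ IH] cD3 unfolding D_def[symmetric] by simp
    \<comment> \<open>\<open>C\<close> may be the larger side here; the parity alternative in
      \<open>wbound_split\<close> covers this.\<close>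
    then have par: "odd (card C)" "even (card D)" using cC n(2) by presburger+
    let ?a = "real (card C)" and ?b = "real (card D)"
    have "{u\<in>C. \<delta> x y u = 1} \<subseteq> l (s - 1)"
    proof
      fix u assume "u \<in> {u\<in>C. \<delta> x y u = 1}"
      then have u: "u \<in> C" "(x, u) \<in> E \<or> (y, u) \<in> E" unfolding frag_layers(5)[OF fr] by auto
      then have "s \<le> Suc (dist E v u)"
        using dist_edge_le[OF v(1), of u x] dist_edge_le[OF v(1), of u y] edge_sym xyV by metis
      then show "u \<in> l (s - 1)" using u(1) by (auto simp: C_def l_def)
    qed
    then have "card {u\<in>C. \<delta> x y u = 1} \<le> card (l (s - 1))" by (rule card_mono[OF fl])
    moreover have "card (l (s - 1)) = 2" using s by (intro below) auto
    ultimately have c2: "card {u\<in>C. \<delta> x y u = 1} \<le> 2" by simp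
    have "\<delta> y x = \<delta> x y" by (auto simp: \<delta>_def min.commute)
    then have bal: "nearer x y C = {}" "nearer y x C = {}"
      using balanced[OF fr C2] balanced[OF frag_commute[OF fr] C2] c2 by auto
    have "l t \<subseteq> {u\<in>D. \<delta> x y u = 1}"
    proof
      fix u assume u: "u \<in> l t"
      then have "u \<in> V" "dist E v u = Suc s" unfolding l_def s(2) by auto
      then obtain w where w: "(w, u) \<in> E" "dist E v w = s" using dist_pred[OF v(1)] by blast
      then have "w \<in> l s" using edge_V by (auto simp: l_def)
      then have "w = x \<or> w = y" unfolding xy(1) by simp
      then have "u \<in> nb x \<union> nb y" using w(1) by auto
      then show "u \<in> {u\<in>D. \<delta> x y u = 1}" unfolding frag_layers(5)[OF frD] using subsetD[OF lD u] by simp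
    qed
    then have "3 \<le> card {u\<in>D. \<delta> x y u = 1}" using big card_mono[of "{u\<in>D. \<delta> x y u = 1}" "l t"] finD by simp
    then have "real (sum (\<delta> x y) D) \<le> ?b + \<phi>\<^sub>2 (card D - 3)"
      using layer_sum2_first[OF frag_layers(1-3)[OF frD]] by blast
    then have "real (sum (\<delta> x y) D) \<le> ?b\<^sup>2 / 4 + 1"
      using cD3 by (simp add: \<phi>\<^sub>2_def of_nat_diff power2_eq_square field_simps)
    then have aSD: "?a * real (sum (\<delta> x y) D) \<le> ?a * (?b\<^sup>2 / 4 + 1)" by (intro mult_left_mono) auto
    have "real (sum (\<delta> x y) C) \<le> (?a + 1)\<^sup>2 / 4"
      using layer_sum2[OF frag_layers(1-3)[OF fr]] by (simp add: \<phi>\<^sub>2_def)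
    then have bSC: "?b * real (sum (\<delta> x y) C) \<le> ?b * ((?a + 1)\<^sup>2 / 4)" by (intro mult_left_mono) auto
    have "real (DS C D) \<le> ?b * real (sum (\<delta> x y) C) + ?a * real (sum (\<delta> x y) D)"
      using DS_cross[OF fr] bal unfolding D_def[symmetric]
      by (simp flip: of_nat_mult of_nat_add of_nat_sum)
    also have "\<dots> \<le> ?b * ((?a + 1)\<^sup>2 / 4) + ?a * (?b\<^sup>2 / 4 + 1)" using bSC aSD by (rule add_mono)
    also have "\<dots> = ?a * ?b * (?a + ?b) / 4 + ?a * ?b + 1 - ?b / 4 - (?a - 1) * (?b - 2) / 2"
      by (simp add: power2_eq_square field_simps)
    also have "\<dots> \<le> ?a * ?b * (?a + ?b) / 4 + ?a * ?b + 1 - ?b / 4"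
      using mult_nonneg_nonneg[of "?a - 1" "?b - 2"] C2 cD3 by simp
    finally show ?thesis
      using bulk_case[OF fr C2 _ IH] par cD3 by (simp add: D_def)
  qed
qed

lemma deg_2_case:
  assumes v: "v \<in> V" "card (nb v) = 2" and n: "5 \<le> card V" and IH: "wiener_below TYPE('a) (card V)"
  shows "real (dist_sum V E) \<le> 2 * wbound (card V)"
proof -
  note del = delete_deg_2[OF v n IH] and st = status_le[OF v(1)]
  consider "even (card V)" | "card V = 5" | "odd (card V)" "7 \<le> card V"
  proof -
    have "card V = 5 \<or> card V = 6 \<or> 7 \<le> card V" using n by linarith
    then show ?thesis using that by auto
  qed
  then show ?thesis
  proof cases
    case 1
    then show ?thesis using del st n wbound_even[OF 1] by simp
  next
    case 2
    then have "real (\<Sum>u\<in>V. dist E v u) \<le> 25 / 4" using st by simp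
    \<comment> \<open>Integrality rounds \<open>25 / 4\<close> down to 6, which is the increment at
      \<open>n = 5\<close>.\<close>
    then have "(\<Sum>u\<in>V. dist E v u) \<le> 6" by linarith
    then have "real (\<Sum>u\<in>V. dist E v u) \<le> 6" by linarith
    then show ?thesis using del wbound_odd[of 5] unfolding 2 by simp
  next
    case 3
    then show ?thesis using wide_deg_2[OF v _ 3(2,1) IH] thin_deg_2[OF v _ 3(2,1) IH] by linarith
  qed
qed

end

lemma dist_sum_le_wbound:
  fixes V :: "'a set"
  assumes "linked_graph V E" "4 \<le> card V"
  shows "real (dist_sum V E) \<le> 2 * wbound (card V)"
  using assms
proof (induction "card V" arbitrary: V E rule: less_induct)
  case less
  interpret linked_graph V E by (rule less.prems)
  have IH: "wiener_below TYPE('a) (card V)" using less.hyps unfolding wiener_below_def by blast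
  show ?case
  proof (cases "card V = 4")
    case True
    have "real (dist_sum V E) = (\<Sum>v\<in>V. real (\<Sum>u\<in>V. dist E v u))" by (simp add: dist_sum_def)
    also have "\<dots> \<le> (\<Sum>v\<in>V. real (card V) ^ 2 / 4)" by (intro sum_mono status_le)
    also have "\<dots> = 16" using True by simp
    finally show ?thesis using True by (simp add: wbound_def)
  next
    case False
    then have n: "5 \<le> card V" using less.prems by simp
    \<comment> \<open>Degree 2 is settled first, so that a smallest separation may be studied with
      minimum degree 3; its side then has more than one vertex.\<close>
    consider (deg2) v where "v \<in> V" "card (nb v) = 2" | (nofrag) "\<And>r s A. \<not> frag r s A"
      | (frag) r s A where "frag r s A" "\<forall>v\<in>V. 3 \<le> card (nb v)"
    proof -
      have "card (nb v) = 2 \<or> 3 \<le> card (nb v)" if "v \<in> V" for v using deg_ge_2[OF that] by linarith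
      then show ?thesis using that by blast
    qed
    then show ?thesis
    proof cases
      case deg2
      then show ?thesis using deg_2_case n IH by blast
    next
      case nofrag
      then show ?thesis using dist_sum_no_frag less.prems(2) by blast
    next
      case frag
      then have "\<exists>C. \<exists>x y. frag x y C" by blast
      then obtain C where C: "\<exists>x y. frag x y C" "\<And>A. \<exists>x y. frag x y A \<Longrightarrow> card C \<le> card A"
        using ex_has_least_nat[of "\<lambda>C. \<exists>x y. frag x y C" _ card] by blast
      then obtain x y where fr: "frag x y C" by blast
      have "card C \<noteq> 1"
      proof
        assume "card C = 1"
        then obtain c where c: "C = {c}" by (auto simp: card_1_singleton_iff)
        then have "nb c \<subseteq> {x, y}" "c \<in> V" using fr edge_irrefl[of c] by (auto simp: frag_def)
        then have "card (nb c) \<le> card {x, y}" "3 \<le> card (nb c)" using frag(2) by (auto intro: card_mono)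
        then show False using fr by (simp add: frag_def)
      qed
      moreover have "card C \<noteq> 0" using frag_layers(1)[OF fr] fr by (simp add: frag_def)
      ultimately have "2 \<le> card C" by linarith
      then show ?thesis using bulb_case[OF fr _ frag(2) _ IH] C(2) by blast
    qed
  qed
qed

section \<open>Quadrangulations are linked\<close>

text \<open>Addition in the vector space of subsets over the field with two elements.\<close>

definition sd :: "'b set \<Rightarrow> 'b set \<Rightarrow> 'b set" where "sd A B = (A - B) \<union> (B - A)"

lemma sd_iff [simp]: "x \<in> sd A B \<longleftrightarrow> (x \<in> A) \<noteq> (x \<in> B)" by (auto simp: sd_def)

lemma sd_subset: "A \<subseteq> S \<Longrightarrow> B \<subseteq> S \<Longrightarrow> sd A B \<subseteq> S" by (auto simp: sd_def)

text \<open>Rank and nullity in counting form: every nonempty fibre of the additive map is a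
  translate of its kernel.\<close>

lemma card_fibres_sd:
  assumes fin: "finite S" and cl: "\<And>A B. A \<in> S \<Longrightarrow> B \<in> S \<Longrightarrow> sd A B \<in> S"
    and add: "\<And>A B. A \<in> S \<Longrightarrow> B \<in> S \<Longrightarrow> \<Phi> (sd A B) = sd (\<Phi> A) (\<Phi> B)"
  shows "card S = card {A\<in>S. \<Phi> A = {}} * card (\<Phi> ` S)"
proof -
  have fibre: "card {A\<in>S. \<Phi> A = y} = card {A\<in>S. \<Phi> A = {}}" if y: "y \<in> \<Phi> ` S" for y
  proof -
    obtain A0 where A0: "A0 \<in> S" "\<Phi> A0 = y" using y by auto
    have inv: "sd A0 (sd A0 A) = A" for A by (auto simp: set_eq_iff)
    have "bij_betw (sd A0) {A\<in>S. \<Phi> A = y} {A\<in>S. \<Phi> A = {}}"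
      by (rule bij_betw_byWitness[where f' = "sd A0"]) (use inv A0 cl add in \<open>auto simp: sd_def\<close>)
    then show ?thesis by (rule bij_betw_same_card)
  qed
  have "card S = (\<Sum>y\<in>\<Phi> ` S. card {A\<in>S. \<Phi> A = y})"
    using sum.image_gen[OF fin, of "\<lambda>_. 1::nat" \<Phi>] by simp
  also have "\<dots> = (\<Sum>y\<in>\<Phi> ` S. card {A\<in>S. \<Phi> A = {}})" using fibre by (intro sum.cong) auto
  finally show ?thesis by simp
qed

lemma odd_card_sd:
  assumes "finite P" "finite Q"
  shows "odd (card (sd P Q)) \<longleftrightarrow> odd (card P) \<noteq> odd (card Q)"
proof -
  have "card (sd P Q) = card (P - Q) + card (Q - P)"
    unfolding sd_def using assms by (intro card_Un_disjoint) auto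
  moreover have "card P = card (P - Q) + card (P \<inter> Q)" "card Q = card (Q - P) + card (P \<inter> Q)"
    using assms card_Int_Diff[of P Q] card_Int_Diff[of Q P] by (auto simp: Int_commute)
  ultimately show ?thesis by auto
qed

locale quad_map = conn_graph +
  fixes \<sigma> :: "'a \<times> 'a \<Rightarrow> 'a \<times> 'a"
  assumes plane: "plane_embedding V E \<sigma>" and faces4: "all_faces_4cycles E \<sigma>" and two: "2 \<le> card V"
begin

abbreviation F where "F \<equiv> face_perm \<sigma>"

lemma \<sigma>_E: "d \<in> E \<Longrightarrow> \<sigma> d \<in> E" "d \<in> E \<Longrightarrow> fst (\<sigma> d) = fst d"
  using plane unfolding plane_embedding_def rotation_system_def bij_betw_def by auto

lemma F_E: "d \<in> E \<Longrightarrow> F d \<in> E" "d \<in> E \<Longrightarrow> fst (F d) = snd d"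
proof -
  assume "d \<in> E"
  then have "(snd d, fst d) \<in> E" using edge_sym by (cases d) auto
  then show "F d \<in> E" "fst (F d) = snd d" using \<sigma>_E by (auto simp: face_perm_def)
qed

lemma face4:
  assumes "d \<in> E"
  shows "F (F (F (F d))) = d" "distinct [fst d, fst (F d), fst (F (F d)), fst (F (F (F d)))]"
proof -
  have *: "(F ^^ 4) d = d" "inj_on (\<lambda>i. fst ((F ^^ i) d)) {0..<4}"
    using faces4 assms by (auto simp: all_faces_4cycles_def)
  show "F (F (F (F d))) = d" using *(1) by (simp add: numeral_eq_Suc)
  have ne: "fst ((F ^^ i) d) \<noteq> fst ((F ^^ j) d)" if "i < j" "j < 4" for i j
    using inj_onD[OF *(2), of i j] that by auto
  show "distinct [fst d, fst (F d), fst (F (F d)), fst (F (F (F d)))]"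
    using ne[of 0 1] ne[of 0 2] ne[of 0 3] ne[of 1 2] ne[of 1 3] ne[of 2 3]
    by (auto simp: numeral_eq_Suc)
qed

text \<open>The face through the dart from \<open>p\<close> to \<open>v\<close> has corners
  \<open>p\<close>, \<open>v\<close>, \<open>q\<close>, \<open>w\<close>, where \<open>q\<close>
  follows \<open>p\<close> in the rotation at \<open>v\<close>. Its fourth corner is the wanted
  common neighbour.\<close>

lemma consecutive:
  assumes "(v, p) \<in> E"
  obtains q w where "\<sigma> (v, p) = (v, q)" "(v, q) \<in> E" "q \<noteq> p" "w \<noteq> v" "(p, w) \<in> E" "(q, w) \<in> E"
proof -
  have pv: "(p, v) \<in> E" using edge_sym assms by blast
  obtain q where q: "F (p, v) = (v, q)" using F_E(2)[OF pv] by (metis prod.collapse snd_conv)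
  have qE: "(v, q) \<in> E" using F_E(1)[OF pv] q by simp
  obtain w where w: "F (v, q) = (q, w)" using F_E(2)[OF qE] by (metis prod.collapse snd_conv)
  have wE: "(q, w) \<in> E" using F_E(1)[OF qE] w by simp
  obtain z where z: "F (q, w) = (w, z)" using F_E(2)[OF wE] by (metis prod.collapse snd_conv)
  have zE: "(w, z) \<in> E" using F_E(1)[OF wE] z by simp
  have "z = p" using F_E(2)[OF zE] face4(1)[OF pv] by (simp add: q w z)
  moreover have "distinct [p, v, q, w]" using face4(2)[OF pv] by (simp add: q w z)
  moreover have "\<sigma> (v, p) = (v, q)" using q by (simp add: face_perm_def)
  ultimately show ?thesis using that[of q w] qE wE zE edge_sym by auto
qed

lemma nb_nonempty: "v \<in> V \<Longrightarrow> nb v \<noteq> {}"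
proof
  assume v: "v \<in> V" and "nb v = {}"
  then have "{v} = V" by (intro closed_eq_V) auto
  then show False using two by (metis card_1_singleton_iff One_nat_def Suc_1 not_less_eq_eq order_refl)
qed

lemma \<sigma>_closed:
  assumes "(v, s) \<in> E" "s \<in> Z" and cl: "\<And>p q. (v, p) \<in> E \<Longrightarrow> p \<in> Z \<Longrightarrow> \<sigma> (v, p) = (v, q) \<Longrightarrow> q \<in> Z"
  shows "nb v \<subseteq> Z"
proof
  fix q assume "q \<in> nb v"
  then have "(v, q) \<in> E" by auto
  moreover have "\<forall>d\<in>E. \<forall>d'\<in>E. fst d = fst d' \<longrightarrow> (\<exists>k. (\<sigma> ^^ k) d = d')"
    using plane unfolding plane_embedding_def rotation_system_def by blast
  ultimately obtain k where k: "(\<sigma> ^^ k) (v, s) = (v, q)" using assms(1) by force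
  have "(\<sigma> ^^ k) (v, s) \<in> E \<and> fst ((\<sigma> ^^ k) (v, s)) = v \<and> snd ((\<sigma> ^^ k) (v, s)) \<in> Z" for k
  proof (induction k)
    case (Suc k)
    then obtain p where p: "(\<sigma> ^^ k) (v, s) = (v, p)" "(v, p) \<in> E" "p \<in> Z" by (metis prod.collapse)
    then show ?case using \<sigma>_E[of "(v, p)"] cl[OF p(2,3)] by (metis comp_apply fst_conv funpow.simps(2) prod.collapse)
  qed (use assms in auto)
  from this[of k] show "q \<in> Z" using k by simp
qed

lemma deg: "v \<in> V \<Longrightarrow> 2 \<le> card (nb v)"
proof -
  assume "v \<in> V"
  then obtain p where p: "(v, p) \<in> E" using nb_nonempty by blast
  then obtain q where "(v, q) \<in> E" "q \<noteq> p" using consecutive by metis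
  then have "card {p, q} \<le> card (nb v)" using p by (intro card_mono) auto
  then show ?thesis using \<open>q \<noteq> p\<close> by simp
qed

text \<open>Without a link the rotation at \<open>v\<close> never steps directly between
  \<open>X\<close> and \<open>Y\<close>. The one neighbour left over has a single successor, so it
  can be joined to one of the two sets to make it closed under the rotation, which however is
  transitive on the darts at \<open>v\<close>.\<close>

lemma rotation_linked:
  assumes X: "X \<noteq> {}" "Y \<noteq> {}" "X \<inter> Y = {}" "X \<union> Y \<subseteq> nb v" and c: "card (nb v - (X \<union> Y)) \<le> 1"
  shows "\<exists>p\<in>X. \<exists>q\<in>Y. \<exists>w. w \<noteq> v \<and> (p, w) \<in> E \<and> (q, w) \<in> E"
proof (rule ccontr)
  assume not: "\<not> ?thesis"
  define R where "R = nb v - (X \<union> Y)"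
  have nbv: "nb v = X \<union> Y \<union> R" using X(4) by (auto simp: R_def)
  have R: "X \<inter> R = {}" "Y \<inter> R = {}" by (auto simp: R_def)
  have step: "q \<notin> Y" if "\<sigma> (v, p) = (v, q)" "p \<in> X" for p q
    using consecutive[of v p] that not X(4) by (metis Image_singleton_iff Pair_inject Un_iff subsetD)
  have step': "q \<notin> X" if "\<sigma> (v, p) = (v, q)" "p \<in> Y" for p q
    using consecutive[of v p] that not X(4) by (metis Image_singleton_iff Pair_inject Un_iff subsetD)
  have nxt: "q \<in> nb v" if "\<sigma> (v, p) = (v, q)" "(v, p) \<in> E" for p q
    using \<sigma>_E(1)[OF that(2)] that by auto
  have "\<exists>s\<in>nb v. s \<in> X \<union> R \<and> (\<forall>p q. \<sigma> (v, p) = (v, q) \<longrightarrow> p \<in> R \<longrightarrow> q \<in> X \<union> R) \<or>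
      s \<in> Y \<union> R \<and> (\<forall>p q. \<sigma> (v, p) = (v, q) \<longrightarrow> p \<in> R \<longrightarrow> q \<in> Y \<union> R)"
  proof (cases "R = {}")
    case True
    then show ?thesis using X by blast
  next
    case False
    then obtain r where r: "R = {r}"
      using c unfolding R_def[symmetric] by (metis One_nat_def R_def card_0_eq card_1_singletonE finite_Diff finite_nb le_SucE le_zero_eq)
    then have rn: "r \<in> nb v" using nbv by blast
    then obtain q where q: "\<sigma> (v, r) = (v, q)" "(v, q) \<in> E" using consecutive[of v r] by blast
    then have "q \<in> X \<union> R \<or> q \<in> Y \<union> R" using nbv by blast
    then show ?thesis using r rn q(1) by (intro bexI[of _ r]) auto
  qed
  then obtain s where s: "s \<in> nb v" and
    alt: "s \<in> X \<union> R \<and> (\<forall>p q. \<sigma> (v, p) = (v, q) \<longrightarrow> p \<in> R \<longrightarrow> q \<in> X \<union> R) \<or>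
      s \<in> Y \<union> R \<and> (\<forall>p q. \<sigma> (v, p) = (v, q) \<longrightarrow> p \<in> R \<longrightarrow> q \<in> Y \<union> R)" by blast
  from alt show False
  proof
    assume A: "s \<in> X \<union> R \<and> (\<forall>p q. \<sigma> (v, p) = (v, q) \<longrightarrow> p \<in> R \<longrightarrow> q \<in> X \<union> R)"
    have "nb v \<subseteq> X \<union> R"
    proof (rule \<sigma>_closed[of v s])
      fix p q assume "(v, p) \<in> E" "p \<in> X \<union> R" "\<sigma> (v, p) = (v, q)"
      then show "q \<in> X \<union> R" using A step[of p q] nxt[of p q] nbv by blast
    qed (use s A in auto)
    then show False using X R nbv by blast
  next
    assume A: "s \<in> Y \<union> R \<and> (\<forall>p q. \<sigma> (v, p) = (v, q) \<longrightarrow> p \<in> R \<longrightarrow> q \<in> Y \<union> R)"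
    have "nb v \<subseteq> Y \<union> R"
    proof (rule \<sigma>_closed[of v s])
      fix p q assume "(v, p) \<in> E" "p \<in> Y \<union> R" "\<sigma> (v, p) = (v, q)"
      then show "q \<in> Y \<union> R" using A step'[of p q] nxt[of p q] nbv by blast
    qed (use s A in auto)
    then show False using X R nbv by blast
  qed
qed

section \<open>Cuts and face parities of edge sets\<close>

definition und :: "'a \<times> 'a \<Rightarrow> 'a set" where "und d = {fst d, snd d}"
definition edges :: "'a set set" where "edges = und ` E"

lemma finite_E [simp]: "finite E"
  using simple unfolding simple_graph_def by (meson finite_SigmaI finite_subset)

lemma und_edges: "d \<in> E \<Longrightarrow> und d \<in> edges" by (simp add: edges_def)

lemma finite_edges [simp]: "finite edges" by (simp add: edges_def)

lemma card_E: "card E = 2 * card edges"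
proof -
  have "card {d\<in>E. und d = e} = 2" if "e \<in> edges" for e
  proof -
    obtain u v where uv: "(u, v) \<in> E" "e = {u, v}" using \<open>e \<in> edges\<close> by (auto simp: edges_def und_def)
    then have "{d\<in>E. und d = e} = {(u, v), (v, u)}"
      using edge_sym by (auto simp: und_def doubleton_eq_iff)
    moreover have "u \<noteq> v" using uv by auto
    ultimately show ?thesis by simp
  qed
  then have "(\<Sum>e\<in>und ` E. card {d\<in>E. und d = e}) = (\<Sum>e\<in>und ` E. 2)"
    by (intro sum.cong) (auto simp: edges_def)
  then show ?thesis using sum.image_gen[OF finite_E, of "\<lambda>_. 1::nat" und] by (simp add: edges_def)
qed

lemma face_of_eq:
  assumes "d \<in> E" shows "face_of \<sigma> d = {d, F d, F (F d), F (F (F d))}"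
proof -
  have "(F ^^ k) d \<in> {d, F d, F (F d), F (F (F d))}" for k
    by (induction k) (use face4(1)[OF assms] in auto)
  moreover have "d = (F ^^ 0) d" "F d = (F ^^ 1) d" "F (F d) = (F ^^ 2) d" "F (F (F d)) = (F ^^ 3) d"
    by (simp_all add: numeral_eq_Suc)
  ultimately show ?thesis unfolding face_of_def by blast
qed

lemma face_of_F: "d \<in> E \<Longrightarrow> face_of \<sigma> (F d) = face_of \<sigma> d"
  by (simp only: face_of_eq F_E(1) face4(1)) blast

lemma face_of_mem:
  assumes d: "d \<in> E"
  shows "d' \<in> face_of \<sigma> d \<longleftrightarrow> d' \<in> E \<and> face_of \<sigma> d' = face_of \<sigma> d"
proof
  have E: "F d \<in> E" "F (F d) \<in> E" "F (F (F d)) \<in> E" using F_E(1) d by auto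
  have "face_of \<sigma> (F d) = face_of \<sigma> d" "face_of \<sigma> (F (F d)) = face_of \<sigma> d"
    "face_of \<sigma> (F (F (F d))) = face_of \<sigma> d"
    using face_of_F d E(1,2) by metis+
  moreover assume "d' \<in> face_of \<sigma> d"
  then have "d' = d \<or> d' = F d \<or> d' = F (F d) \<or> d' = F (F (F d))"
    unfolding face_of_eq[OF d] by blast
  ultimately show "d' \<in> E \<and> face_of \<sigma> d' = face_of \<sigma> d" using d E by metis
next
  assume "d' \<in> E \<and> face_of \<sigma> d' = face_of \<sigma> d"
  then show "d' \<in> face_of \<sigma> d" using face_of_eq[of d'] by blast
qed

lemma finite_faces [simp]: "finite (faces E \<sigma>)" by (simp add: faces_def)

lemma finite_face: "f \<in> faces E \<sigma> \<Longrightarrow> finite f"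
  by (auto simp: faces_def face_of_eq)

definition cut :: "'a set \<Rightarrow> 'a set set" where
  "cut U = {e\<in>edges. e \<inter> U \<noteq> {} \<and> \<not> e \<subseteq> U}"

text \<open>The coboundary map of the dual graph modulo 2. Darts are counted, so an edge with the
  same face on both sides contributes nothing.\<close>

definition odd_faces :: "'a set set \<Rightarrow> ('a \<times> 'a) set set" where
  "odd_faces A = {f\<in>faces E \<sigma>. odd (card {d\<in>f. und d \<in> A})}"

lemma cut_iff: "(u, v) \<in> E \<Longrightarrow> und (u, v) \<in> cut U \<longleftrightarrow> (u \<in> U) \<noteq> (v \<in> U)"
  using und_edges[of "(u, v)"] by (auto simp: cut_def und_def)

lemma cut_sd: "cut (sd A B) = sd (cut A) (cut B)"
proof (rule set_eqI)
  fix e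
  show "e \<in> cut (sd A B) \<longleftrightarrow> e \<in> sd (cut A) (cut B)"
  proof (cases "e \<in> edges")
    case True
    then obtain u v where "(u, v) \<in> E" "e = und (u, v)" by (auto simp: edges_def)
    then show ?thesis by (auto simp: cut_iff)
  qed (auto simp: cut_def)
qed

lemma odd_faces_sd: "odd_faces (sd A B) = sd (odd_faces A) (odd_faces B)"
proof -
  have "odd (card {d\<in>f. und d \<in> sd A B}) \<longleftrightarrow>
      odd (card {d\<in>f. und d \<in> A}) \<noteq> odd (card {d\<in>f. und d \<in> B})" if "f \<in> faces E \<sigma>" for f
  proof -
    have eq: "{d\<in>f. und d \<in> sd A B} = sd {d\<in>f. und d \<in> A} {d\<in>f. und d \<in> B}" by auto
    show ?thesis unfolding eq by (rule odd_card_sd) (use finite_face[OF that] in auto)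
  qed
  then show ?thesis unfolding odd_faces_def by (auto simp: set_eq_iff)
qed

lemma card_face_filter:
  assumes d: "d \<in> E"
  shows "card {d'\<in>face_of \<sigma> d. P d'} = of_bool (P d) + of_bool (P (F d)) + of_bool (P (F (F d)))
    + of_bool (P (F (F (F d))))"
proof -
  have dis: "distinct [d, F d, F (F d), F (F (F d))]" using face4(2)[OF d] by auto
  have "card {d'\<in>face_of \<sigma> d. P d'} = (\<Sum>d'\<in>face_of \<sigma> d. of_bool (P d'))"
    by (subst card_eq_sum, rule sum.mono_neutral_cong_left) (auto simp: face_of_eq[OF d])
  also have "\<dots> = of_bool (P d) + of_bool (P (F d)) + of_bool (P (F (F d))) + of_bool (P (F (F (F d))))"
    unfolding face_of_eq[OF d] using dis by simp
  finally show ?thesis .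
qed

lemma odd_faces_edges: "odd_faces edges = {}"
proof -
  have "even (card {d'\<in>face_of \<sigma> d. und d' \<in> edges})" if "d \<in> E" for d
    using card_face_filter[OF that, of "\<lambda>d. und d \<in> edges"] F_E that by (simp add: edges_def)
  then show ?thesis by (auto simp: odd_faces_def faces_def)
qed

text \<open>Going once around a face, membership in \<open>U\<close> changes an even number of
  times.\<close>

lemma odd_faces_cut: "odd_faces (cut U) = {}"
proof -
  have "even (card {d'\<in>face_of \<sigma> d. und d' \<in> cut U})" if d: "d \<in> E" for d
  proof -
    let ?P = "\<lambda>d. und d \<in> cut U"
    have P: "?P e \<longleftrightarrow> (fst e \<in> U) \<noteq> (fst (F e) \<in> U)" if "e \<in> E" for e
      using cut_iff[of "fst e" "snd e" U] F_E(2)[OF that] that by simp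
    have E: "F d \<in> E" "F (F d) \<in> E" "F (F (F d)) \<in> E" using F_E d by auto
    show ?thesis
      unfolding card_face_filter[OF d, of ?P] P[OF d] P[OF E(1)] P[OF E(2)] P[OF E(3)] face4(1)[OF d]
      by (cases "fst d \<in> U"; cases "fst (F d) \<in> U"; cases "fst (F (F d)) \<in> U"; cases "fst (F (F (F d))) \<in> U") auto
  qed
  then show ?thesis by (auto simp: odd_faces_def faces_def)
qed

lemma odd_faces_single:
  assumes "(u, v) \<in> E"
  shows "odd_faces {und (u, v)} = sd {face_of \<sigma> (u, v)} {face_of \<sigma> (v, u)}"
proof -
  have vu: "(v, u) \<in> E" and uv: "u \<noteq> v" using assms edge_sym by auto
  have "odd (card {d\<in>f. und d = und (u, v)}) \<longleftrightarrow> (f = face_of \<sigma> (u, v)) \<noteq> (f = face_of \<sigma> (v, u))"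
    if f: "f \<in> faces E \<sigma>" for f
  proof -
    have mem: "d \<in> f \<longleftrightarrow> f = face_of \<sigma> d" if "d \<in> E" for d
    proof -
      obtain d1 where "d1 \<in> E" "f = face_of \<sigma> d1" using f by (auto simp: faces_def)
      then show ?thesis using face_of_mem[of d1 d] that by auto
    qed
    have "{d\<in>f. und d = und (u, v)} = (if (u, v) \<in> f then {(u, v)} else {}) \<union> (if (v, u) \<in> f then {(v, u)} else {})"
      by (auto simp: und_def doubleton_eq_iff)
    then show ?thesis using mem[OF assms] mem[OF vu] uv by auto
  qed
  moreover have "face_of \<sigma> (u, v) \<in> faces E \<sigma>" "face_of \<sigma> (v, u) \<in> faces E \<sigma>"
    using assms vu by (auto simp: faces_def)
  ultimately show ?thesis unfolding odd_faces_def by (intro set_eqI) auto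
qed

text \<open>Connectedness of the dual: the image has index at most 2 among all sets of faces. Being
  \<open>good\<close> passes from a dart to its reverse by adding one edge, and along the rotation
  because \<open>\<sigma> (u, v)\<close> lies on the face of \<open>(v, u)\<close>.\<close>

lemma odd_faces_image:
  assumes d0: "d0 \<in> E" and Y: "Y \<subseteq> faces E \<sigma>"
  defines "I \<equiv> odd_faces ` Pow edges"
  shows "Y \<in> I \<or> sd Y {face_of \<sigma> d0} \<in> I"
proof -
  have I_sd: "sd A B \<in> I" if "A \<in> I" "B \<in> I" for A B
  proof -
    obtain A' B' where "A' \<subseteq> edges" "B' \<subseteq> edges" "A = odd_faces A'" "B = odd_faces B'"
      using \<open>A \<in> I\<close> \<open>B \<in> I\<close> by (auto simp: I_def)
    then show ?thesis unfolding I_def odd_faces_sd[symmetric] by (simp add: odd_faces_sd[symmetric]) (auto simp: sd_def)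
  qed
  have I0: "{} \<in> I" unfolding I_def by (rule image_eqI[of _ _ "{}"]) (auto simp: odd_faces_def)
  let ?f = "face_of \<sigma>"
  define good where "good d \<longleftrightarrow> sd {?f d} {?f d0} \<in> I" for d
  have good_rev: "good (v, u)" if "(u, v) \<in> E" "good (u, v)" for u v
  proof -
    have "odd_faces {und (u, v)} \<in> I" unfolding I_def using that by (intro imageI) (auto simp: edges_def)
    then have "sd (sd {?f (u, v)} {?f (v, u)}) (sd {?f (u, v)} {?f d0}) \<in> I"
      using I_sd that odd_faces_single by (simp add: good_def)
    also have "sd (sd {?f (u, v)} {?f (v, u)}) (sd {?f (u, v)} {?f d0}) = sd {?f (v, u)} {?f d0}"
      by (intro set_eqI) auto
    finally show ?thesis by (simp add: good_def)
  qed
  have good_\<sigma>: "good (\<sigma> (u, v))" if "(u, v) \<in> E" "good (u, v)" for u v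
  proof -
    have "\<sigma> (u, v) = F (v, u)" by (simp add: face_perm_def)
    moreover have "?f (F (v, u)) = ?f (v, u)" using face_of_F that edge_sym by blast
    ultimately show ?thesis using good_rev[OF that] by (simp add: good_def)
  qed
  have good_all: "good (u, w)" if "(u, v) \<in> E" "good (u, v)" "(u, w) \<in> E" for u v w
  proof -
    have "nb u \<subseteq> {w. good (u, w)}"
      by (rule \<sigma>_closed[OF that(1)]) (use that good_\<sigma> in \<open>force+\<close>)
    then show ?thesis using that by auto
  qed
  have "{v\<in>V. \<forall>w. (v, w) \<in> E \<longrightarrow> good (v, w)} = V"
  proof (rule closed_eq_V)
    have "good d0" using I0 by (simp add: good_def sd_def)
    then have "fst d0 \<in> {v\<in>V. \<forall>w. (v, w) \<in> E \<longrightarrow> good (v, w)}"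
      using good_all[of "fst d0" "snd d0"] d0 edge_V[of "fst d0" "snd d0"] by auto
    then show "{v\<in>V. \<forall>w. (v, w) \<in> E \<longrightarrow> good (v, w)} \<noteq> {}" by blast
    show "E `` {v\<in>V. \<forall>w. (v, w) \<in> E \<longrightarrow> good (v, w)} \<subseteq> {v\<in>V. \<forall>w. (v, w) \<in> E \<longrightarrow> good (v, w)}"
      using good_rev good_all edge_V edge_sym by blast
  qed auto
  then have good: "good d" if "d \<in> E" for d using that edge_V[of "fst d" "snd d"] by (cases d) auto
  have "finite Y" using Y finite_faces finite_subset by blast
  then show ?thesis using Y
  proof (induction Y)
    case empty
    then show ?case using I0 by simp
  next
    case (insert f Y)
    then obtain d where "d \<in> E" "f = ?f d" by (auto simp: faces_def)
    then have f: "sd {f} {?f d0} \<in> I" using good by (simp add: good_def)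
    have "sd (insert f Y) {?f d0} = sd Y (sd {f} {?f d0})"
      using insert.hyps by (intro set_eqI) auto
    moreover have "insert f Y = sd (sd Y {?f d0}) (sd {f} {?f d0})"
      using insert.hyps by (intro set_eqI) auto
    ultimately show ?case using insert.IH insert.prems I_sd f by (metis insert_subset)
  qed
qed

text \<open>Over the field with two elements, connectedness of the graph and of its dual show that the
space of cuts has dimension \<open>n - 1\<close> and that of the edge sets meeting every face evenly has
dimension \<open>e - f + 1\<close>. By Euler's formula they agree, so the set of all edges is a cut.\<close>

lemma two_colourable: "\<exists>c :: 'a \<Rightarrow> bool. \<forall>u v. (u, v) \<in> E \<longrightarrow> c u \<noteq> c v"
proof -
  let ?I = "odd_faces ` Pow edges" and ?Z = "{A\<in>Pow edges. odd_faces A = {}}"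
  let ?f = "card (faces E \<sigma>)"
  obtain v where "v \<in> V" using connected by (auto simp: connected_graph_def)
  then obtain d0 where d0: "d0 \<in> E" using nb_nonempty by blast
  have euler: "card V + ?f = card edges + 2"
    using plane card_E unfolding plane_embedding_def by simp
  have "card (Pow V) = card {U\<in>Pow V. cut U = {}} * card (cut ` Pow V)"
    by (rule card_fibres_sd) (simp_all add: cut_sd sd_subset)
  \<comment> \<open>A set with empty cut is closed under adjacency, so each cut comes from at most
    two vertex sets.\<close>
  moreover have "{U\<in>Pow V. cut U = {}} \<subseteq> {{}, V}"
  proof
    fix U assume U: "U \<in> {U\<in>Pow V. cut U = {}}"
    have "E `` U \<subseteq> U" using U cut_iff by blast
    then show "U \<in> {{}, V}" using closed_eq_V[of U] U by auto
  qed
  then have "card {U\<in>Pow V. cut U = {}} \<le> card {{}, V}" by (intro card_mono) auto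
  then have "card {U\<in>Pow V. cut U = {}} \<le> 2" using card_insert_le_m1[of 2 "{V}" "{}"] by (simp add: card_insert_if split: if_splits)
  ultimately have 1: "2 ^ card V \<le> 2 * card (cut ` Pow V)" by (simp add: card_Pow mult_right_mono)
  have 2: "2 ^ card edges = card ?Z * card ?I"
    unfolding card_Pow[OF finite_edges, symmetric]
    by (rule card_fibres_sd) (simp_all add: odd_faces_sd sd_subset)
  have "Pow (faces E \<sigma>) \<subseteq> ?I \<union> (\<lambda>Y. sd Y {face_of \<sigma> d0}) ` ?I"
  proof
    fix Y assume "Y \<in> Pow (faces E \<sigma>)"
    then have "Y \<in> ?I \<or> sd Y {face_of \<sigma> d0} \<in> ?I" using odd_faces_image[OF d0] by simp
    moreover have "Y = sd (sd Y {face_of \<sigma> d0}) {face_of \<sigma> d0}" by (intro set_eqI) auto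
    ultimately show "Y \<in> ?I \<union> (\<lambda>Y. sd Y {face_of \<sigma> d0}) ` ?I" by blast
  qed
  then have "card (Pow (faces E \<sigma>)) \<le> card (?I \<union> (\<lambda>Y. sd Y {face_of \<sigma> d0}) ` ?I)"
    by (intro card_mono) auto
  also have "\<dots> \<le> card ?I + card ((\<lambda>Y. sd Y {face_of \<sigma> d0}) ` ?I)" by (rule card_Un_le)
  also have "\<dots> \<le> card ?I + card ?I" by (intro add_left_mono card_image_le) auto
  finally have 3: "2 ^ ?f \<le> 2 * card ?I" by (simp add: card_Pow)
  \<comment> \<open>Euler's formula enters as
    \<open>4 * 2 ^ card edges = 2 ^ card V * 2 ^ ?f\<close>, with the left side split by rank and
    nullity.\<close>
  have "2 * (card ?Z * 2 ^ ?f) \<le> 2 * (card ?Z * (2 * card ?I))"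
    using 3 by (intro mult_left_mono) auto
  also have "\<dots> = 2 ^ card V * 2 ^ ?f"
    using euler 2 by (simp add: power_add[symmetric])
  also have "\<dots> \<le> 2 * card (cut ` Pow V) * 2 ^ ?f" using 1 by (rule mult_right_mono) simp
  finally have "card ?Z \<le> card (cut ` Pow V)" by (simp add: mult.assoc)
  moreover have "cut ` Pow V \<subseteq> ?Z" using odd_faces_cut by (auto simp: cut_def)
  ultimately have "cut ` Pow V = ?Z" by (intro card_seteq) auto
  moreover have "edges \<in> ?Z" using odd_faces_edges by simp
  ultimately obtain U where "cut U = edges" by (metis (no_types, lifting) imageE)
  then have "(u \<in> U) \<noteq> (v \<in> U)" if "(u, v) \<in> E" for u v
    using cut_iff[OF that] that by (auto simp: edges_def)
  then show ?thesis by (intro exI[of _ "\<lambda>u. u \<in> U"]) blast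
qed

lemma linked_graph: "linked_graph V E"
proof unfold_locales
  show "\<exists>c :: 'a \<Rightarrow> bool. \<forall>u v. (u, v) \<in> E \<longrightarrow> c u \<noteq> c v" by (rule two_colourable)
qed (erule deg, erule (4) rotation_linked)

end

theorem theorem2:
  fixes V :: "'a set" and E :: "('a \<times> 'a) set"
  assumes "quadrangulation V E" and "card V \<ge> 4"
  shows "wiener V E \<le>
    (if even (card V)
     then real (card V) ^ 3 / 12 + 7 / 6 * real (card V) - 2
     else real (card V) ^ 3 / 12 + 11 / 12 * real (card V) - 1)"
proof -
  obtain \<sigma> where \<sigma>: "plane_embedding V E \<sigma>" "all_faces_4cycles E \<sigma>"
    and "simple_graph V E" "connected_graph V E"
    using assms(1) by (auto simp: quadrangulation_def)
  then interpret quad_map V E \<sigma> using assms(2) by unfold_locales auto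
  have "real (dist_sum V E) \<le> 2 * wbound (card V)"
    using dist_sum_le_wbound[OF linked_graph assms(2)] .
  then have "wiener V E \<le> wbound (card V)" by (simp add: wiener_def dist_sum_def)
  then show ?thesis unfolding wbound_def .
qed

end
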